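(* Work in intuitionistic (higher-type) arithmetic and assume the restricted unique countable choice principle AC!$^{0,\mathbb{B}}$: $\forall x^{\mathbb{N}}\exists! y^{\mathbb{B}} A(x,y) \to \exists f^{\mathbb{N}\to\mathbb{B}}\forall x^{\mathbb{N}} A(x,f(x))$ for every formula $A$. Assume also the principle EnDec: for every enumerable set $B\subseteq\mathbb{N}$, if for every decidable $C\subseteq B$ we have that $\exists m\,(m\notin C)$ implies $\exists m\,(m\notin C\wedge m\in B)$, then $\mathbb{N}\subseteq B$. Then Open Induction on Cantor space holds: for every non-empty open set $U\subseteq\mathbb{B}^\omega$, \[ \forall\alpha\big(\forall\beta<\alpha\,(\beta\in U)\to\alpha\in U\big)\to\forall\alpha\,(\alpha\in U). \]
   Context: $\mathbb{B}=\{0,1\}$ with $0<_{\mathbb{B}}1$. $\mathbb{B}^\omega$ is the set of infinite binary sequences $\alpha,\beta,\dots$ and $\mathbb{B}^*$ the set of finite binary sequences; $\overline\alpha n=\langle\alpha(0),\dots,\alpha(n-1)\rangle$. The lexicographic order on $\mathbb{B}^\omega$ is: $\beta<\alpha$ iff $\exists n(\overline\beta n=\overline\alpha n\wedge\beta(n)=0\wedge\alpha(n)=1)$. A non-empty set $U\subseteq\mathbb{B}^\omega$ is open if there is an enumeration $\pi:\mathbb{N}\to\mathbb{B}^*$ with $\alpha\in U$ iff $\exists n\exists k(\overline\alpha n=\pi(k))$. A $\Sigma$-formula is one built only from existential quantifiers over $\mathbb{N}$, disjunction, conjunction and equality of natural numbers (equivalently a $\Sigma^0_1$-formula in a language with all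 primitive recursive function symbols). A set $B\subseteq\mathbb{N}$ is enumerable if membership $n\in B$ is given by a $\Sigma$-formula; $C\subseteq\mathbb{N}$ is decidable if $\forall n(n\in C\vee n\notin C)$. The underlying logic is intuitionistic. *)

theory Defs
  imports Main
begin

text \<open>
  HOL is classical, and classically the principles below hold outright, so the intuitionistic
  system is represented as an object theory: intuitionistic arithmetic in all finite types
  (combinators and primitive recursors, with intensional equality at every type) with a natural
  deduction calculus. The base types are the natural numbers, the booleans
  \<open>{0,1}\<close>, and the finite binary sequences; infinite binary sequences are
  functions from naturals to booleans.
\<close>

datatype ty = TN | TB | TSeq | TFun ty ty  (infixr \<open>\<rightharpoondown>\<close> 70)

text \<open>
  Besides the finite types there is a sort of subsets of \<open>\<nat>\<close>, needed because the set
  \<open>C\<close> is quantified inside the premise of EnDec. It has no closed terms and is not a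
  finite type. No comprehension is built in: the calculus is relative to a theory \<open>T\<close>,
  which may contain as much comprehension as desired.
\<close>

datatype sort = Ty ty | PowN

abbreviation cantor :: ty where
  "cantor \<equiv> TN \<rightharpoondown> TB"

datatype cst =
    CK ty ty | CS ty ty ty
  | CZero | CSuc | CRecN ty
  | CB0 | CB1 | CCond ty
  | CEmpty | CSnoc | CRecSeq ty

text \<open>Sequences are built by appending at the end: \<open>CSnoc\<close> takes the new last entry first.\<close>

fun cst_ty :: "cst \<Rightarrow> ty" where
  "cst_ty (CK a b) = a \<rightharpoondown> b \<rightharpoondown> a"
| "cst_ty (CS a b c) = (a \<rightharpoondown> b \<rightharpoondown> c) \<rightharpoondown> (a \<rightharpoondown> b) \<rightharpoondown> a \<rightharpoondown> c"
| "cst_ty CZero = TN"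
| "cst_ty CSuc = TN \<rightharpoondown> TN"
| "cst_ty (CRecN a) = a \<rightharpoondown> (TN \<rightharpoondown> a \<rightharpoondown> a) \<rightharpoondown> TN \<rightharpoondown> a"
| "cst_ty CB0 = TB"
| "cst_ty CB1 = TB"
| "cst_ty (CCond a) = a \<rightharpoondown> a \<rightharpoondown> TB \<rightharpoondown> a"
| "cst_ty CEmpty = TSeq"
| "cst_ty CSnoc = TB \<rightharpoondown> TSeq \<rightharpoondown> TSeq"
| "cst_ty (CRecSeq a) = a \<rightharpoondown> (TB \<rightharpoondown> TSeq \<rightharpoondown> a \<rightharpoondown> a) \<rightharpoondown> TSeq \<rightharpoondown> a"

text \<open>Variables are de Bruijn indices; terms contain no binders.\<close>

datatype tm = Var nat | Con cst | App tm tm  (infixl \<open>\<bullet>\<close> 75)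

type_synonym ctx = "sort list"

inductive has_sort :: "ctx \<Rightarrow> tm \<Rightarrow> sort \<Rightarrow> bool" where
  "n < length E \<Longrightarrow> has_sort E (Var n) (E ! n)"
| "has_sort E (Con c) (Ty (cst_ty c))"
| "has_sort E s (Ty (a \<rightharpoondown> b)) \<Longrightarrow> has_sort E t (Ty a) \<Longrightarrow> has_sort E (s \<bullet> t) (Ty b)"

datatype fm =
    Bot
  | Eq ty tm tm
  | Mem tm tm
  | And fm fm
  | Or fm fm
  | Imp fm fm
  | All sort fm
  | Ex sort fm

abbreviation Not :: "fm \<Rightarrow> fm" where
  "Not A \<equiv> Imp A Bot"

abbreviation Iff :: "fm \<Rightarrow> fm \<Rightarrow> fm" where
  "Iff A B \<equiv> And (Imp A B) (Imp B A)"

primrec wf_fm :: "ctx \<Rightarrow> fm \<Rightarrow> bool" where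
  "wf_fm E Bot \<longleftrightarrow> True"
| "wf_fm E (Eq a s t) \<longleftrightarrow> has_sort E s (Ty a) \<and> has_sort E t (Ty a)"
| "wf_fm E (Mem t C) \<longleftrightarrow> has_sort E t (Ty TN) \<and> has_sort E C PowN"
| "wf_fm E (And A B) \<longleftrightarrow> wf_fm E A \<and> wf_fm E B"
| "wf_fm E (Or A B) \<longleftrightarrow> wf_fm E A \<and> wf_fm E B"
| "wf_fm E (Imp A B) \<longleftrightarrow> wf_fm E A \<and> wf_fm E B"
| "wf_fm E (All s A) \<longleftrightarrow> wf_fm (s # E) A"
| "wf_fm E (Ex s A) \<longleftrightarrow> wf_fm (s # E) A"

primrec tsubst :: "(nat \<Rightarrow> tm) \<Rightarrow> tm \<Rightarrow> tm" where
  "tsubst \<sigma> (Var n) = \<sigma> n"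
| "tsubst \<sigma> (Con c) = Con c"
| "tsubst \<sigma> (s \<bullet> t) = tsubst \<sigma> s \<bullet> tsubst \<sigma> t"

abbreviation tlift :: "tm \<Rightarrow> tm" where
  "tlift \<equiv> tsubst (\<lambda>n. Var (Suc n))"

definition up :: "(nat \<Rightarrow> tm) \<Rightarrow> nat \<Rightarrow> tm" where
  "up \<sigma> = case_nat (Var 0) (\<lambda>n. tlift (\<sigma> n))"

primrec subst :: "(nat \<Rightarrow> tm) \<Rightarrow> fm \<Rightarrow> fm" where
  "subst \<sigma> Bot = Bot"
| "subst \<sigma> (Eq a s t) = Eq a (tsubst \<sigma> s) (tsubst \<sigma> t)"
| "subst \<sigma> (Mem t C) = Mem (tsubst \<sigma> t) (tsubst \<sigma> C)"
| "subst \<sigma> (And A B) = And (subst \<sigma> A) (subst \<sigma> B)"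
| "subst \<sigma> (Or A B) = Or (subst \<sigma> A) (subst \<sigma> B)"
| "subst \<sigma> (Imp A B) = Imp (subst \<sigma> A) (subst \<sigma> B)"
| "subst \<sigma> (All s A) = All s (subst (up \<sigma>) A)"
| "subst \<sigma> (Ex s A) = Ex s (subst (up \<sigma>) A)"

abbreviation lift :: "fm \<Rightarrow> fm" where
  "lift \<equiv> subst (\<lambda>n. Var (Suc n))"

definition inst :: "tm \<Rightarrow> fm \<Rightarrow> fm" where
  "inst t A = subst (case_nat t Var) A"

text \<open>Keeps variable 0 and makes room for one fresh variable directly above it.\<close>

definition lift1 :: "fm \<Rightarrow> fm" where
  "lift1 A = subst (case_nat (Var 0) (\<lambda>n. Var (n + 2))) A"

inductive ha_axiom :: "ctx \<Rightarrow> fm \<Rightarrow> bool" where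
  eq_refl:
    "has_sort E t (Ty a) \<Longrightarrow> ha_axiom E (Eq a t t)"
| eq_replace:
    "has_sort E s (Ty a) \<Longrightarrow> has_sort E t (Ty a) \<Longrightarrow> wf_fm (Ty a # E) A \<Longrightarrow>
     ha_axiom E (Imp (Eq a s t) (Imp (inst s A) (inst t A)))"
| comb_K:
    "has_sort E s (Ty a) \<Longrightarrow> has_sort E t (Ty b) \<Longrightarrow>
     ha_axiom E (Eq a (Con (CK a b) \<bullet> s \<bullet> t) s)"
| comb_S:
    "has_sort E r (Ty (a \<rightharpoondown> b \<rightharpoondown> c)) \<Longrightarrow> has_sort E s (Ty (a \<rightharpoondown> b)) \<Longrightarrow> has_sort E t (Ty a) \<Longrightarrow>
     ha_axiom E (Eq c (Con (CS a b c) \<bullet> r \<bullet> s \<bullet> t) (r \<bullet> t \<bullet> (s \<bullet> t)))"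
| zero_not_suc:
    "has_sort E t (Ty TN) \<Longrightarrow> ha_axiom E (Not (Eq TN (Con CZero) (Con CSuc \<bullet> t)))"
| suc_inj:
    "has_sort E s (Ty TN) \<Longrightarrow> has_sort E t (Ty TN) \<Longrightarrow>
     ha_axiom E (Imp (Eq TN (Con CSuc \<bullet> s) (Con CSuc \<bullet> t)) (Eq TN s t))"
| recN_zero:
    "has_sort E p (Ty a) \<Longrightarrow> has_sort E q (Ty (TN \<rightharpoondown> a \<rightharpoondown> a)) \<Longrightarrow>
     ha_axiom E (Eq a (Con (CRecN a) \<bullet> p \<bullet> q \<bullet> Con CZero) p)"
| recN_suc:
    "has_sort E p (Ty a) \<Longrightarrow> has_sort E q (Ty (TN \<rightharpoondown> a \<rightharpoondown> a)) \<Longrightarrow> has_sort E t (Ty TN) \<Longrightarrow>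
     ha_axiom E (Eq a (Con (CRecN a) \<bullet> p \<bullet> q \<bullet> (Con CSuc \<bullet> t))
                      (q \<bullet> t \<bullet> (Con (CRecN a) \<bullet> p \<bullet> q \<bullet> t)))"
| cond_0:
    "has_sort E p (Ty a) \<Longrightarrow> has_sort E q (Ty a) \<Longrightarrow>
     ha_axiom E (Eq a (Con (CCond a) \<bullet> p \<bullet> q \<bullet> Con CB0) p)"
| cond_1:
    "has_sort E p (Ty a) \<Longrightarrow> has_sort E q (Ty a) \<Longrightarrow>
     ha_axiom E (Eq a (Con (CCond a) \<bullet> p \<bullet> q \<bullet> Con CB1) q)"
| recSeq_empty:
    "has_sort E p (Ty a) \<Longrightarrow> has_sort E q (Ty (TB \<rightharpoondown> TSeq \<rightharpoondown> a \<rightharpoondown> a)) \<Longrightarrow>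
     ha_axiom E (Eq a (Con (CRecSeq a) \<bullet> p \<bullet> q \<bullet> Con CEmpty) p)"
| recSeq_snoc:
    "has_sort E p (Ty a) \<Longrightarrow> has_sort E q (Ty (TB \<rightharpoondown> TSeq \<rightharpoondown> a \<rightharpoondown> a)) \<Longrightarrow>
     has_sort E b (Ty TB) \<Longrightarrow> has_sort E u (Ty TSeq) \<Longrightarrow>
     ha_axiom E (Eq a (Con (CRecSeq a) \<bullet> p \<bullet> q \<bullet> (Con CSnoc \<bullet> b \<bullet> u))
                      (q \<bullet> b \<bullet> u \<bullet> (Con (CRecSeq a) \<bullet> p \<bullet> q \<bullet> u)))"
| ind_N:
    "wf_fm (Ty TN # E) A \<Longrightarrow>
     ha_axiom E
       (Imp (inst (Con CZero) A)
       (Imp (All (Ty TN) (Imp A (subst (case_nat (Con CSuc \<bullet> Var 0) (\<lambda>n. Var (Suc n))) A)))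
            (All (Ty TN) A)))"
| ind_B:
    "wf_fm (Ty TB # E) A \<Longrightarrow>
     ha_axiom E (Imp (inst (Con CB0) A) (Imp (inst (Con CB1) A) (All (Ty TB) A)))"
| ind_Seq:
    "wf_fm (Ty TSeq # E) A \<Longrightarrow>
     ha_axiom E
       (Imp (inst (Con CEmpty) A)
       (Imp (All (Ty TSeq) (Imp A (All (Ty TB)
              (subst (case_nat (Con CSnoc \<bullet> Var 0 \<bullet> Var 1) (\<lambda>n. Var (n + 2))) A))))
            (All (Ty TSeq) A)))"

text \<open>
  A theory is a set of formulas in context; \<open>derivable T E \<Gamma> A\<close> is intuitionistic
  derivability of \<open>A\<close> from the assumptions \<open>\<Gamma>\<close>, all with free
  variables sorted by \<open>E\<close>, in arithmetic extended by the axioms \<open>T\<close>.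
\<close>

type_synonym thy = "(ctx \<times> fm) set"

inductive derivable :: "thy \<Rightarrow> ctx \<Rightarrow> fm set \<Rightarrow> fm \<Rightarrow> bool" for T :: thy where
  Hyp: "A \<in> \<Gamma> \<Longrightarrow> wf_fm E A \<Longrightarrow> derivable T E \<Gamma> A"
| Arith: "ha_axiom E A \<Longrightarrow> derivable T E \<Gamma> A"
| Ax: "(E, A) \<in> T \<Longrightarrow> wf_fm E A \<Longrightarrow> derivable T E \<Gamma> A"
| BotE: "derivable T E \<Gamma> Bot \<Longrightarrow> wf_fm E A \<Longrightarrow> derivable T E \<Gamma> A"
| AndI: "derivable T E \<Gamma> A \<Longrightarrow> derivable T E \<Gamma> B \<Longrightarrow> derivable T E \<Gamma> (And A B)"
| AndE1: "derivable T E \<Gamma> (And A B) \<Longrightarrow> derivable T E \<Gamma> A"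
| AndE2: "derivable T E \<Gamma> (And A B) \<Longrightarrow> derivable T E \<Gamma> B"
| OrI1: "derivable T E \<Gamma> A \<Longrightarrow> wf_fm E B \<Longrightarrow> derivable T E \<Gamma> (Or A B)"
| OrI2: "wf_fm E A \<Longrightarrow> derivable T E \<Gamma> B \<Longrightarrow> derivable T E \<Gamma> (Or A B)"
| OrE: "derivable T E \<Gamma> (Or A B) \<Longrightarrow> derivable T E (insert A \<Gamma>) C \<Longrightarrow>
        derivable T E (insert B \<Gamma>) C \<Longrightarrow> derivable T E \<Gamma> C"
| ImpI: "wf_fm E A \<Longrightarrow> derivable T E (insert A \<Gamma>) B \<Longrightarrow> derivable T E \<Gamma> (Imp A B)"
| ImpE: "derivable T E \<Gamma> (Imp A B) \<Longrightarrow> derivable T E \<Gamma> A \<Longrightarrow> derivable T E \<Gamma> B"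
| AllI: "derivable T (s # E) (lift ` \<Gamma>) A \<Longrightarrow> derivable T E \<Gamma> (All s A)"
| AllE: "derivable T E \<Gamma> (All s A) \<Longrightarrow> has_sort E t s \<Longrightarrow> derivable T E \<Gamma> (inst t A)"
| ExI: "wf_fm (s # E) A \<Longrightarrow> has_sort E t s \<Longrightarrow> derivable T E \<Gamma> (inst t A) \<Longrightarrow>
        derivable T E \<Gamma> (Ex s A)"
| ExE: "derivable T E \<Gamma> (Ex s A) \<Longrightarrow> wf_fm E C \<Longrightarrow>
        derivable T (s # E) (insert A (lift ` \<Gamma>)) (lift C) \<Longrightarrow> derivable T E \<Gamma> C"

inductive sigma_fm :: "fm \<Rightarrow> bool" where
  "sigma_fm (Eq TN s t)"
| "sigma_fm A \<Longrightarrow> sigma_fm B \<Longrightarrow> sigma_fm (And A B)"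
| "sigma_fm A \<Longrightarrow> sigma_fm B \<Longrightarrow> sigma_fm (Or A B)"
| "sigma_fm A \<Longrightarrow> sigma_fm (Ex (Ty TN) A)"

definition Ex1 :: "ty \<Rightarrow> fm \<Rightarrow> fm" where
  "Ex1 a A = Ex (Ty a) (And A (All (Ty a) (Imp (lift1 A) (Eq a (Var 0) (Var 1)))))"

text \<open>In \<open>A\<close>, variable 0 is \<open>y\<close> and variable 1 is \<open>x\<close>.\<close>

definition AC_fm :: "fm \<Rightarrow> fm" where
  "AC_fm A =
     Imp (All (Ty TN) (Ex1 TB A))
         (Ex (Ty (TN \<rightharpoondown> TB)) (All (Ty TN)
           (subst (case_nat (Var 1 \<bullet> Var 0) (case_nat (Var 0) (\<lambda>n. Var (n + 2)))) A)))"

definition AC_unique_0B :: thy where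
  "AC_unique_0B = {(E, AC_fm A) | E A. wf_fm (Ty TB # Ty TN # E) A}"

text \<open>In \<open>B\<close>, variable 0 is the candidate element; under \<open>All PowN\<close> the set \<open>C\<close> is variable 0.\<close>

definition decidable_set :: "tm \<Rightarrow> fm" where
  "decidable_set C = All (Ty TN) (Or (Mem (Var 0) (tlift C)) (Not (Mem (Var 0) (tlift C))))"

definition EnDec_fm :: "fm \<Rightarrow> fm" where
  "EnDec_fm B =
     Imp (All PowN
           (Imp (And (decidable_set (Var 0))
                     (All (Ty TN) (Imp (Mem (Var 0) (Var 1)) (lift1 B))))
           (Imp (Ex (Ty TN) (Not (Mem (Var 0) (Var 1))))
                (Ex (Ty TN) (And (Not (Mem (Var 0) (Var 1))) (lift1 B))))))
         (All (Ty TN) B)"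

definition EnDec :: thy where
  "EnDec = {(E, EnDec_fm B) | E B. sigma_fm B \<and> wf_fm (Ty TN # E) B}"

text \<open>
  The initial segment of length \<open>n\<close>: the recursion step
  \<open>S (K snoc) \<alpha>\<close> sends \<open>k\<close> and \<open>u\<close> to \<open>u\<close>
  extended by \<open>\<alpha> k\<close>.
\<close>

definition init_seg :: "tm \<Rightarrow> tm \<Rightarrow> tm" where
  "init_seg \<alpha> n =
     Con (CRecN TSeq) \<bullet> Con CEmpty
       \<bullet> (Con (CS TN TB (TSeq \<rightharpoondown> TSeq)) \<bullet> (Con (CK (TB \<rightharpoondown> TSeq \<rightharpoondown> TSeq) TN) \<bullet> Con CSnoc) \<bullet> \<alpha>)
       \<bullet> n"

definition lex_less :: "tm \<Rightarrow> tm \<Rightarrow> fm" where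
  "lex_less \<beta> \<alpha> =
     Ex (Ty TN)
       (And (Eq TSeq (init_seg (tlift \<beta>) (Var 0)) (init_seg (tlift \<alpha>) (Var 0)))
       (And (Eq TB (tlift \<beta> \<bullet> Var 0) (Con CB0))
            (Eq TB (tlift \<alpha> \<bullet> Var 0) (Con CB1))))"

definition enum_by :: "tm \<Rightarrow> tm \<Rightarrow> fm" where
  "enum_by \<pi> \<alpha> =
     Ex (Ty TN) (Ex (Ty TN)
       (Eq TSeq (init_seg (tlift (tlift \<alpha>)) (Var 1)) (tlift (tlift \<pi>) \<bullet> Var 0)))"

text \<open>In \<open>U\<close>, variable 0 is the candidate point of Cantor space.\<close>

definition open_fm :: "fm \<Rightarrow> fm" where
  "open_fm U =
     Ex (Ty (TN \<rightharpoondown> TSeq)) (All (Ty cantor) (Iff (lift1 U) (enum_by (Var 1) (Var 0))))"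

definition OI_fm :: "fm \<Rightarrow> fm" where
  "OI_fm U =
     Imp (And (Ex (Ty cantor) U) (open_fm U))
    (Imp (All (Ty cantor)
           (Imp (All (Ty cantor) (Imp (lex_less (Var 0) (Var 1)) (lift1 U))) U))
         (All (Ty cantor) U))"

definition open_induction :: thy where
  "open_induction = {(E, OI_fm U) | E U. wf_fm (Ty cantor # E) U}"

end

theory Submission
  imports Defs
begin

text \<open>
  Let \<open>U\<close> be progressive and open, enumerated by \<open>p\<close>. Call a finite sequence barred if it is
  generated from the values of \<open>p\<close> by passing from both children of a node to the node; this is a
  \<open>\<Sigma>\<close>-property, and every infinite sequence through a barred node lies in \<open>U\<close>. Apply EnDec to the
  set \<open>B\<close> of (codes of) sequences \<open>u\<close> such that \<open>u\<close> or the empty sequence is barred. Given a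
  decidable \<open>C \<subseteq> B\<close>, AC! yields its characteristic function, hence the branch \<open>a\<close> that turns right at
  a node exactly if the left child of the node is in \<open>C\<close>. Any \<open>b < a\<close> passes through an element of
  \<open>C\<close>, so \<open>b \<in> U\<close>; by progressivity \<open>a \<in> U\<close>, so some initial segment of \<open>a\<close> is barred. Going back
  along \<open>a\<close> from there, either \<open>a\<close> turns left, into a barred node outside \<open>C\<close>, or both children are
  barred and so is the shorter segment; at the root, everything is in \<open>B\<close>. Thus EnDec gives that
  the empty sequence is barred, and \<open>U\<close> is everything. As \<open>C\<close> is only quantified over, no
  comprehension is needed.
\<close>

section \<open>Sorts and substitution\<close>

text \<open>Sorts are unique, so the sorting relation is the graph of a partial function; used for
  simplification, it discharges sort conditions by computation.\<close>

fun srt :: "ctx \<Rightarrow> tm \<Rightarrow> sort option" where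
  "srt E (Var n) = (if n < length E then Some (E ! n) else None)"
| "srt E (Con c) = Some (Ty (cst_ty c))"
| "srt E (s \<bullet> t) =
     (case srt E s of
        Some (Ty (a \<rightharpoondown> b)) \<Rightarrow> if srt E t = Some (Ty a) then Some (Ty b) else None
      | _ \<Rightarrow> None)"

lemma has_sort_iff [simp]: "has_sort E t s \<longleftrightarrow> srt E t = Some s"
proof
  show "has_sort E t s \<Longrightarrow> srt E t = Some s"
    by (induction rule: has_sort.induct) auto
  show "srt E t = Some s \<Longrightarrow> has_sort E t s"
    by (induction t arbitrary: s)
      (auto intro: has_sort.intros split: if_splits option.splits sort.splits ty.splits)
qed

lemma tsubst_tsubst [simp]: "tsubst \<sigma> (tsubst \<tau> t) = tsubst (\<lambda>n. tsubst \<sigma> (\<tau> n)) t"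
  by (induction t) auto

lemma tsubst_Var [simp]: "tsubst Var t = t"
  by (induction t) auto

lemma up_simps [simp]:
  "up \<sigma> 0 = Var 0"
  "up \<sigma> (Suc n) = tlift (\<sigma> n)"
  "up \<sigma> (numeral k) = tlift (\<sigma> (pred_numeral k))"
  by (simp_all add: up_def numeral_eq_Suc)

text \<open>De Bruijn indices are written as numerals such as \<open>Var 2\<close>; this lets the
  simplifier look them up in a substitution.\<close>

lemma case_nat_numeral_eq [simp]: "case_nat x f (numeral k) = f (pred_numeral k)"
  by (simp add: numeral_eq_Suc)

lemma up_Var [simp]: "up Var = Var"
  by (rule ext) (simp add: up_def split: nat.splits)

lemma subst_subst [simp]: "subst \<sigma> (subst \<tau> A) = subst (\<lambda>n. tsubst \<sigma> (\<tau> n)) A"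
proof (induction A arbitrary: \<sigma> \<tau>)
  have up: "(\<lambda>n. tsubst (up \<sigma>) (up \<tau> n)) = up (\<lambda>n. tsubst \<sigma> (\<tau> n))" for \<sigma> \<tau>
    by (rule ext) (simp add: up_def split: nat.splits)
  {
    case (All s A) then show ?case by (simp add: up)
  next
    case (Ex s A) then show ?case by (simp add: up)
  }
qed auto

lemma subst_Var [simp]: "subst Var A = A"
  by (induction A) auto

lemma srt_tsubst:
  assumes "srt E t = Some s" "\<And>n. n < length E \<Longrightarrow> srt F (\<sigma> n) = Some (E ! n)"
  shows "srt F (tsubst \<sigma> t) = Some s"
  using assms
  by (induction t arbitrary: s) (auto split: if_splits option.splits sort.splits ty.splits)

text \<open>Iterated lifts are fused into a single substitution by \<open>tsubst_tsubst\<close>; in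
  that shape each \<open>Suc\<close> is paid off by one entry of the context.\<close>

lemma srt_lift [simp]:
  "srt (s # E) (tsubst (\<lambda>n. Var (Suc (f n))) t) = srt E (tsubst (\<lambda>n. Var (f n)) t)"
  by (induction t) (auto split: option.splits sort.splits ty.splits)

lemma wf_subst:
  assumes "wf_fm E A" "\<And>n. n < length E \<Longrightarrow> srt F (\<sigma> n) = Some (E ! n)"
  shows "wf_fm F (subst \<sigma> A)"
  using assms
proof (induction A arbitrary: E F \<sigma>)
  have up: "srt (s # F) (up \<sigma> n) = Some ((s # E) ! n)"
    if "\<And>n. n < length E \<Longrightarrow> srt F (\<sigma> n) = Some (E ! n)" "n < length (s # E)" for s E F \<sigma> n
    using that by (cases n) auto
  {
    case (All s A)
    show ?case using All.prems by (auto intro!: All.IH[where E = "s # E"] up)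
  next
    case (Ex s A)
    show ?case using Ex.prems by (auto intro!: Ex.IH[where E = "s # E"] up)
  }
qed (auto intro: srt_tsubst)

lemma wf_inst: "wf_fm (s # E) A \<Longrightarrow> srt E t = Some s \<Longrightarrow> wf_fm E (inst t A)"
  unfolding inst_def by (erule wf_subst) (auto split: nat.splits)

lemma wf_lift: "wf_fm E A \<Longrightarrow> wf_fm (s # E) (lift A)"
  by (erule wf_subst) auto

lemma ha_axiom_wf: "ha_axiom E A \<Longrightarrow> wf_fm E A"
  by (induction rule: ha_axiom.induct)
    (auto intro!: wf_inst intro: wf_subst simp: nth_Cons split: nat.splits)

section \<open>Programs\<close>

abbreviation "zero \<equiv> Con CZero"
abbreviation "suc t \<equiv> Con CSuc \<bullet> t"
abbreviation "b0 \<equiv> Con CB0"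
abbreviation "b1 \<equiv> Con CB1"
abbreviation "nil \<equiv> Con CEmpty"
abbreviation "snoc b u \<equiv> Con CSnoc \<bullet> b \<bullet> u"
abbreviation "cond a p q b \<equiv> Con (CCond a) \<bullet> p \<bullet> q \<bullet> b"
abbreviation "recN a p q n \<equiv> Con (CRecN a) \<bullet> p \<bullet> q \<bullet> n"
abbreviation "recSeq a p q u \<equiv> Con (CRecSeq a) \<bullet> p \<bullet> q \<bullet> u"

section \<open>Bracket abstraction\<close>

text \<open>The constants \<open>CK\<close> and \<open>CS\<close> carry their types, so abstraction
  must know the types of subterms. On ill-typed terms the value has no meaning.\<close>

fun tyof :: "ty list \<Rightarrow> tm \<Rightarrow> ty" where
  "tyof V (Var n) = V ! n"
| "tyof V (Con c) = cst_ty c"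
| "tyof V (s \<bullet> t) = (case tyof V s of a \<rightharpoondown> b \<Rightarrow> b | a \<Rightarrow> a)"

text \<open>Bracket abstraction of variable 0 of type \<open>a\<close>; \<open>V\<close> types the remaining variables.\<close>

fun lam :: "ty list \<Rightarrow> ty \<Rightarrow> tm \<Rightarrow> tm" where
  "lam V a (Var 0) = Con (CS a (a \<rightharpoondown> a) a) \<bullet> Con (CK a (a \<rightharpoondown> a)) \<bullet> Con (CK a a)"
| "lam V a (Var (Suc n)) = Con (CK (V ! n) a) \<bullet> Var n"
| "lam V a (Con c) = Con (CK (cst_ty c) a) \<bullet> Con c"
| "lam V a (s \<bullet> t) =
     Con (CS a (tyof (a # V) t) (tyof (a # V) (s \<bullet> t))) \<bullet> lam V a s \<bullet> lam V a t"

lemma tyof_eq: "srt (map Ty V) t = Some (Ty a) \<Longrightarrow> tyof V t = a"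
  by (induction V t arbitrary: a rule: tyof.induct)
    (auto split: if_splits option.splits sort.splits ty.splits)

lemma srt_App_cases:
  assumes "srt E (s \<bullet> t) = Some r"
  obtains a b where "r = Ty b" "srt E s = Some (Ty (a \<rightharpoondown> b))" "srt E t = Some (Ty a)"
  using assms by (auto split: if_splits option.splits sort.splits ty.splits)

lemma srt_lam:
  "srt (map Ty (a # V)) t = Some (Ty b) \<Longrightarrow> srt (map Ty V) (lam V a t) = Some (Ty (a \<rightharpoondown> b))"
proof (induction V a t arbitrary: b rule: lam.induct)
  case (4 V a s t)
  from 4(3) obtain c where c: "srt (map Ty (a # V)) s = Some (Ty (c \<rightharpoondown> b))"
    "srt (map Ty (a # V)) t = Some (Ty c)" by (rule srt_App_cases) auto
  show ?case
    using 4(1)[OF c(1)] 4(2)[OF c(2)] tyof_eq[OF c(1)] tyof_eq[OF c(2)] by simp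
qed (auto split: if_splits)

declare lam.simps [simp del]

lemma srt_closed: "srt [] t = Some s \<Longrightarrow> srt E t = Some s"
  using srt_tsubst[of "[]" t s E Var] by simp

lemma tsubst_closed: "srt [] t = Some s \<Longrightarrow> tsubst \<sigma> t = t"
  by (induction t arbitrary: s) (auto elim!: srt_App_cases split: if_splits simp del: srt.simps(3))

section \<open>Numbering of binary sequences\<close>

text \<open>A recursion step takes the predecessor first and the value so far last; hence
  \<open>Var 0\<close> is the value so far.\<close>

definition dbl_step :: tm where
  "dbl_step = lam [] TN (lam [TN] TN (suc (suc (Var 0))))"

definition add_step :: tm where
  "add_step = lam [] TN (lam [TN] TN (suc (Var 0)))"

abbreviation "dbl n \<equiv> recN TN zero dbl_step n"
abbreviation "add n m \<equiv> recN TN n add_step m"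

text \<open>Counting with the last entry as least significant digit: a last 0 becomes 1, a last 1
  becomes 0 with a carry into the rest. \<open>cond\<close> lists the value at 0 first.\<close>

definition inc_step :: tm where
  "inc_step = lam [] TB (lam [TB] TSeq (lam [TSeq, TB] TSeq
     (cond TSeq (snoc b1 (Var 1)) (snoc b0 (Var 0)) (Var 2))))"

abbreviation "inc u \<equiv> recSeq TSeq (snoc b0 nil) inc_step u"

definition dec_step :: tm where
  "dec_step = lam [] TN (lam [TN] TSeq (inc (Var 0)))"

definition enc_step :: tm where
  "enc_step = lam [] TB (lam [TB] TSeq (lam [TSeq, TB] TN
     (cond TN (suc (dbl (Var 0))) (suc (suc (dbl (Var 0)))) (Var 2))))"

text \<open>
  Bijective binary numeration: \<open>inc\<close> passes from the \<open>n\<close>-th binary word \<open>dec n\<close> to the next one.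
\<close>

abbreviation "dec n \<equiv> recN TSeq nil dec_step n"
abbreviation "enc u \<equiv> recSeq TN zero enc_step u"

section \<open>Equality test, covering stages and the branch\<close>

definition const0 :: tm where
  "const0 = lam [] TN (lam [TN] TB b0)"

text \<open>Applied to a function and used as a recursion step, it drops the recursive value and
  calls the function at the predecessor: the recursor becomes a case distinction.\<close>

definition peel :: tm where
  "peel = lam [] cantor (lam [cantor] TN (lam [TN, cantor] TB (Var 2 \<bullet> Var 1)))"

text \<open>Recursion on the first number produces the whole test function for the second: the
  successor case answers 0 at \<open>zero\<close> and otherwise compares predecessors.\<close>

definition eqn_step :: tm where
  "eqn_step = lam [] TN (lam [TN] cantor (lam [cantor, TN] TN
     (recN TB b0 (peel \<bullet> Var 1) (Var 0))))"

abbreviation "eqn n m \<equiv> recN cantor (Con (CRecN TB) \<bullet> b1 \<bullet> const0) eqn_step n \<bullet> m"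

abbreviation "bor x y \<equiv> cond TB y b1 x"
abbreviation "band x y \<equiv> cond TB b0 y x"

text \<open>\<open>Var 3\<close> to \<open>Var 0\<close> are the enumeration, the stage number, the
  test for that stage and the node. Nodes are compared through their codes because the equality test
  is one for numbers.\<close>

definition cov_step :: tm where
  "cov_step = lam [] (TN \<rightharpoondown> TSeq) (lam [TN \<rightharpoondown> TSeq] TN (lam [TN, TN \<rightharpoondown> TSeq] (TSeq \<rightharpoondown> TB)
     (lam [TSeq \<rightharpoondown> TB, TN, TN \<rightharpoondown> TSeq] TSeq
       (bor (Var 1 \<bullet> Var 0)
         (bor (eqn (enc (Var 0)) (enc (Var 3 \<bullet> Var 2)))
           (band (Var 1 \<bullet> snoc b0 (Var 0)) (Var 1 \<bullet> snoc b1 (Var 0))))))))"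

text \<open>
  \<open>cov p n u\<close> decides whether \<open>u\<close> is obtained from \<open>p 0\<close>, \<dots>, \<open>p (n - 1)\<close> in at most \<open>n\<close> steps, where
  one may pass to \<open>u\<close> from its two children together.
\<close>

abbreviation "cov p n u \<equiv> recN (TSeq \<rightharpoondown> TB) (Con (CK TB TSeq) \<bullet> b0) (cov_step \<bullet> p) n \<bullet> u"

text \<open>Each bit of the branch depends on the node reached so far, so the recursion builds nodes
  rather than bits.\<close>

definition path_step :: tm where
  "path_step = lam [] cantor (lam [cantor] TN (lam [TN, cantor] TSeq
     (snoc (Var 2 \<bullet> enc (snoc b0 (Var 0))) (Var 0))))"

abbreviation "path_seq f n \<equiv> recN TSeq nil (path_step \<bullet> f) n"

text \<open>
  If \<open>f\<close> is the characteristic function of a set \<open>C\<close> of codes, \<open>branch f\<close> turns left exactly at those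
  nodes whose left child is not in \<open>C\<close>.
\<close>

definition branch :: tm where
  "branch = lam [] cantor (lam [cantor] TN (Var 1 \<bullet> enc (snoc b0 (path_seq (Var 1) (Var 0)))))"

text \<open>Programs are closed terms, hence sorted alike in every context and fixed by
  substitution. Recorded as simplification rules, these facts keep the definitions folded.\<close>

lemma closed2:
  assumes "c = lam [] a (lam [a] b t)" "srt [Ty b, Ty a] t = Some (Ty r)"
  shows "srt E c = Some (Ty (a \<rightharpoondown> b \<rightharpoondown> r))" "tsubst \<sigma> c = c"
proof -
  have "srt [] c = Some (Ty (a \<rightharpoondown> b \<rightharpoondown> r))"
    using srt_lam[of a "[]" "lam [a] b t"] srt_lam[of b "[a]" t r] assms by simp
  then show "srt E c = Some (Ty (a \<rightharpoondown> b \<rightharpoondown> r))" "tsubst \<sigma> c = c"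
    by (rule srt_closed, rule tsubst_closed)
qed

lemma closed3:
  assumes "d = lam [] a (lam [a] b (lam [b, a] c t))" "srt [Ty c, Ty b, Ty a] t = Some (Ty r)"
  shows "srt E d = Some (Ty (a \<rightharpoondown> b \<rightharpoondown> c \<rightharpoondown> r))" "tsubst \<sigma> d = d"
  using closed2[OF assms(1)] srt_lam[of c "[b, a]" t r] assms(2) by simp_all

lemma closed4:
  assumes "e = lam [] a (lam [a] b (lam [b, a] c (lam [c, b, a] d t)))"
    and "srt [Ty d, Ty c, Ty b, Ty a] t = Some (Ty r)"
  shows "srt E e = Some (Ty (a \<rightharpoondown> b \<rightharpoondown> c \<rightharpoondown> d \<rightharpoondown> r))" "tsubst \<sigma> e = e"
  using closed3[OF assms(1)] srt_lam[of d "[c, b, a]" t r] assms(2) by simp_all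

lemmas [simp] = closed2[OF dbl_step_def, simplified]
lemmas [simp] = closed2[OF add_step_def, simplified]
lemmas [simp] = closed3[OF inc_step_def, simplified]
lemmas [simp] = closed2[OF dec_step_def, simplified]
lemmas [simp] = closed3[OF enc_step_def, simplified]
lemmas [simp] = closed2[OF const0_def, simplified]
lemmas [simp] = closed3[OF peel_def, simplified]
lemmas [simp] = closed3[OF eqn_step_def, simplified]
lemmas [simp] = closed4[OF cov_step_def, simplified]
lemmas [simp] = closed3[OF path_step_def, simplified]
lemmas [simp] = closed2[OF branch_def, simplified]

section \<open>Barred sequences\<close>

lemma tsubst_init_seg [simp]: "tsubst \<sigma> (init_seg a n) = init_seg (tsubst \<sigma> a) (tsubst \<sigma> n)"
  by (simp add: init_seg_def)

lemma srt_init_seg [simp]: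
  "srt E a = Some (Ty cantor) \<Longrightarrow> srt E n = Some (Ty TN) \<Longrightarrow> srt E (init_seg a n) = Some (Ty TSeq)"
  by (simp add: init_seg_def)

lemma subst_enum_by [simp]: "subst \<sigma> (enum_by p a) = enum_by (tsubst \<sigma> p) (tsubst \<sigma> a)"
  by (simp add: enum_by_def)

lemma wf_enum_by [simp]:
  "srt E p = Some (Ty (TN \<rightharpoondown> TSeq)) \<Longrightarrow> srt E a = Some (Ty cantor) \<Longrightarrow> wf_fm E (enum_by p a)"
  by (simp add: enum_by_def)

text \<open>
  \<open>Eq TN (cond TN (suc zero) zero b) zero\<close> renders \<open>b = 1\<close> as an equation of numbers, so that
  \<open>barred p u\<close> is a \<open>\<Sigma>\<close>-formula.
\<close>

definition barred :: "tm \<Rightarrow> tm \<Rightarrow> fm" where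
  "barred p u =
     Ex (Ty TN) (Eq TN (cond TN (suc zero) zero (cov (tlift p) (Var 0) (tlift u))) zero)"

lemma subst_barred [simp]: "subst \<sigma> (barred p u) = barred (tsubst \<sigma> p) (tsubst \<sigma> u)"
  by (simp add: barred_def)

lemma wf_barred [simp]:
  "srt E p = Some (Ty (TN \<rightharpoondown> TSeq)) \<Longrightarrow> srt E u = Some (Ty TSeq) \<Longrightarrow> wf_fm E (barred p u)"
  by (simp add: barred_def)

lemma sigma_barred: "sigma_fm (barred p u)"
  unfolding barred_def by (intro sigma_fm.intros)

lemma subst_lex_less [simp]: "subst \<sigma> (lex_less b a) = lex_less (tsubst \<sigma> b) (tsubst \<sigma> a)"
  by (simp add: lex_less_def)

lemma wf_lex_less [simp]:
  "srt E b = Some (Ty cantor) \<Longrightarrow> srt E a = Some (Ty cantor) \<Longrightarrow> wf_fm E (lex_less b a)"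
  by (simp add: lex_less_def)

section \<open>Formulas of the main argument\<close>

text \<open>Bit and membership are decided together in each disjunct; this is the relation to which
  unique choice is applied.\<close>

definition char_of :: "tm \<Rightarrow> tm \<Rightarrow> fm" where
  "char_of f C = All (Ty TN)
     (Or (And (Eq TB (tlift f \<bullet> Var 0) b1) (Mem (Var 0) (tlift C)))
         (And (Eq TB (tlift f \<bullet> Var 0) b0) (Not (Mem (Var 0) (tlift C)))))"

text \<open>The second disjunct makes every number good as soon as the root is barred, which is what
  the way back along the branch may end with.\<close>

definition good :: "tm \<Rightarrow> tm \<Rightarrow> fm" where
  "good p m = Or (barred p (dec m)) (barred p nil)"

text \<open>This and the next two formulas are the constituents of \<open>EnDec_fm\<close> when
  \<open>B\<close> is the set \<open>good\<close>.\<close>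

definition good_subset :: "tm \<Rightarrow> tm \<Rightarrow> fm" where
  "good_subset C p = All (Ty TN) (Imp (Mem (Var 0) (tlift C)) (good (tlift p) (Var 0)))"

definition proper :: "tm \<Rightarrow> fm" where
  "proper C = Ex (Ty TN) (Not (Mem (Var 0) (tlift C)))"

definition good_outside :: "tm \<Rightarrow> tm \<Rightarrow> fm" where
  "good_outside C p = Ex (Ty TN) (And (Not (Mem (Var 0) (tlift C))) (good (tlift p) (Var 0)))"

text \<open>Stated for \<open>enum_by\<close> in place of \<open>U\<close>, so that the main
  argument speaks of the enumeration alone.\<close>

definition progressive :: "tm \<Rightarrow> fm" where
  "progressive p = All (Ty cantor)
     (Imp (All (Ty cantor) (Imp (lex_less (Var 0) (Var 1)) (enum_by (tlift (tlift p)) (Var 0))))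
       (enum_by (tlift p) (Var 0)))"

lemma subst_good [simp]: "subst \<sigma> (good p m) = good (tsubst \<sigma> p) (tsubst \<sigma> m)"
  by (simp add: good_def)

lemma subst_defs [simp]:
  "subst \<sigma> (char_of f C) = char_of (tsubst \<sigma> f) (tsubst \<sigma> C)"
  "subst \<sigma> (good_subset C p) = good_subset (tsubst \<sigma> C) (tsubst \<sigma> p)"
  "subst \<sigma> (proper C) = proper (tsubst \<sigma> C)"
  "subst \<sigma> (good_outside C p) = good_outside (tsubst \<sigma> C) (tsubst \<sigma> p)"
  "subst \<sigma> (progressive p) = progressive (tsubst \<sigma> p)"
  "subst \<sigma> (decidable_set C) = decidable_set (tsubst \<sigma> C)"
  by (simp_all add: char_of_def good_subset_def proper_def good_outside_def progressive_def
      decidable_set_def)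

lemma wf_good [simp]:
  "srt E p = Some (Ty (TN \<rightharpoondown> TSeq)) \<Longrightarrow> srt E m = Some (Ty TN) \<Longrightarrow> wf_fm E (good p m)"
  by (simp add: good_def)

lemma wf_defs [simp]:
  "srt E f = Some (Ty cantor) \<Longrightarrow> srt E C = Some PowN \<Longrightarrow> wf_fm E (char_of f C)"
  "srt E C = Some PowN \<Longrightarrow> srt E p = Some (Ty (TN \<rightharpoondown> TSeq)) \<Longrightarrow> wf_fm E (good_subset C p)"
  "srt E C = Some PowN \<Longrightarrow> wf_fm E (proper C)"
  "srt E C = Some PowN \<Longrightarrow> srt E p = Some (Ty (TN \<rightharpoondown> TSeq)) \<Longrightarrow> wf_fm E (good_outside C p)"
  "srt E p = Some (Ty (TN \<rightharpoondown> TSeq)) \<Longrightarrow> wf_fm E (progressive p)"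
  "srt E C = Some PowN \<Longrightarrow> wf_fm E (decidable_set C)"
  by (simp_all add: char_of_def good_subset_def proper_def good_outside_def progressive_def
      decidable_set_def)

text \<open>The standing assumptions of the argument along the branch; as a set given by three terms
  it commutes with lifting.\<close>

definition hyps :: "tm \<Rightarrow> tm \<Rightarrow> tm \<Rightarrow> fm set" where
  "hyps f C p = {char_of f C, good_subset C p, proper C, progressive p}"

lemma lift_hyps [simp]: "lift ` hyps f C p = hyps (tlift f) (tlift C) (tlift p)"
  by (simp add: hyps_def)

text \<open>Lifting under a binder is the renaming used in \<open>lift1\<close>; with the two facts
  below, renamings of \<open>U\<close> reduce to a common form.\<close>

lemma up_lift: "up (\<lambda>n. Var (Suc n)) = case_nat (Var 0) (\<lambda>n. Var (n + 2))"
  by (rule ext) (simp add: up_def split: nat.splits)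

lemma case_nat_Var: "case_nat (Var 0) (\<lambda>n. Var (Suc n)) = Var"
  by (rule ext) (simp split: nat.splits)

lemma tsubst_case_nat: "(\<lambda>n. tsubst \<sigma> (case_nat x f n)) = case_nat (tsubst \<sigma> x) (\<lambda>n. tsubst \<sigma> (f n))"
  by (rule ext) (simp split: nat.splits)

section \<open>Derivations\<close>

context
  fixes T :: thy
begin

abbreviation (input) entails :: "ctx \<Rightarrow> fm set \<Rightarrow> fm \<Rightarrow> bool"  (\<open>(_;/ _/ \<turnstile> _)\<close> [51, 51, 51] 50) where
  "E; G \<turnstile> A \<equiv> derivable T E G A"

section \<open>Structural rules and equality\<close>

text \<open>Later proofs read the sorts of terms off the formulas already derived.\<close>

lemma entails_wf: "E; G \<turnstile> A \<Longrightarrow> wf_fm E A"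
proof (induction rule: derivable.induct)
  case (AllE E G s A t)
  then show ?case by (auto intro: wf_inst)
qed (auto dest: ha_axiom_wf)

lemma weaken: "E; G \<turnstile> A \<Longrightarrow> G \<subseteq> G' \<Longrightarrow> E; G' \<turnstile> A"
proof (induction arbitrary: G' rule: derivable.induct)
  case (OrE E G A B C) 
  show ?case by (rule derivable.OrE[of _ _ _ A B]) (use OrE.IH OrE.prems in \<open>simp_all only: insert_mono\<close>)
next
  case (ExE E G s A C)
  then have "s # E; insert A (lift ` G') \<turnstile> lift C" by (simp only: image_mono insert_mono)
  then show ?case using ExE by (blast intro: derivable.ExE)
next
  case (AllE E G s A t)
  then show ?case by (blast intro: derivable.AllE)
next
  case (ImpE E G s A t)
  then show ?case by (blast intro: derivable.ImpE)
next
  case (AndE1 E G s A)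
  then show ?case by (blast intro: derivable.AndE1)
next
  case (AndE2 E G s A)
  then show ?case by (blast intro: derivable.AndE2)
next
  case (ImpI E A G B)
  then have "E; insert A G' \<turnstile> B" by (simp only: insert_mono)
  with ImpI show ?case by (blast intro: derivable.ImpI)
next
  case (AllI s E G A)
  then have "s # E; lift ` G' \<turnstile> A" by (simp only: image_mono)
  then show ?case by (rule derivable.AllI)
qed (auto intro: derivable.intros)

lemma weaken_insert: "E; G \<turnstile> A \<Longrightarrow> E; insert B G \<turnstile> A"
  by (erule weaken) auto

lemma cut: "E; G \<turnstile> A \<Longrightarrow> E; insert A G \<turnstile> B \<Longrightarrow> E; G \<turnstile> B"
  by (rule derivable.ImpE[OF derivable.ImpI]) (auto dest: entails_wf)

lemma hyp: "wf_fm E A \<Longrightarrow> E; insert A G \<turnstile> A"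
  by (rule derivable.Hyp) auto

lemma all_elim: "E; G \<turnstile> All s A \<Longrightarrow> srt E t = Some s \<Longrightarrow> B = inst t A \<Longrightarrow> E; G \<turnstile> B"
  using derivable.AllE by simp

lemma ex_intro: "E; G \<turnstile> inst t A \<Longrightarrow> wf_fm (s # E) A \<Longrightarrow> srt E t = Some s \<Longrightarrow> E; G \<turnstile> Ex s A"
  using derivable.ExI by simp

lemma replace:
  assumes "E; G \<turnstile> Eq a s t" "E; G \<turnstile> inst s A" "wf_fm (Ty a # E) A"
  shows "E; G \<turnstile> inst t A"
  using assms entails_wf[OF assms(1)]
  by (auto intro: derivable.ImpE[OF derivable.ImpE[OF derivable.Arith[OF ha_axiom.eq_replace]]])

lemma eqv_refl: "srt E t = Some (Ty a) \<Longrightarrow> E; G \<turnstile> Eq a t t"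
  by (rule derivable.Arith, rule ha_axiom.eq_refl) simp

lemma eqv_sym: assumes "E; G \<turnstile> Eq a s t" shows "E; G \<turnstile> Eq a t s"
  using replace[OF assms, of "Eq a (Var 0) (tlift s)"] entails_wf[OF assms]
  by (auto simp: inst_def intro: eqv_refl)

lemma eqv_trans [trans]:
  assumes "E; G \<turnstile> Eq a r s" "E; G \<turnstile> Eq a s t" shows "E; G \<turnstile> Eq a r t"
  using replace[OF assms(2), of "Eq a (tlift r) (Var 0)"] assms(1) entails_wf[OF assms(1)]
  by (auto simp: inst_def)

lemma eqv_cong:
  assumes "E; G \<turnstile> Eq (a \<rightharpoondown> b) f g" "E; G \<turnstile> Eq a s t" shows "E; G \<turnstile> Eq b (f \<bullet> s) (g \<bullet> t)"
proof -
  note wf = entails_wf[OF assms(1)] entails_wf[OF assms(2)]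
  have "E; G \<turnstile> Eq b (f \<bullet> s) (g \<bullet> s)"
    using replace[OF assms(1), of "Eq b (tlift (f \<bullet> s)) (Var 0 \<bullet> tlift s)"] wf
    by (simp add: inst_def eqv_refl)
  moreover have "E; G \<turnstile> Eq b (g \<bullet> s) (g \<bullet> t)"
    using replace[OF assms(2), of "Eq b (tlift (g \<bullet> s)) (tlift g \<bullet> Var 0)"] wf
    by (simp add: inst_def eqv_refl)
  ultimately show ?thesis by (rule eqv_trans)
qed

lemma eqv_cong_arg:
  "E; G \<turnstile> Eq a s t \<Longrightarrow> srt E f = Some (Ty (a \<rightharpoondown> b)) \<Longrightarrow> E; G \<turnstile> Eq b (f \<bullet> s) (f \<bullet> t)"
  by (rule eqv_cong[OF eqv_refl])

lemma eqv_cong_fun: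
  "E; G \<turnstile> Eq (a \<rightharpoondown> b) f g \<Longrightarrow> srt E t = Some (Ty a) \<Longrightarrow> E; G \<turnstile> Eq b (f \<bullet> t) (g \<bullet> t)"
  by (rule eqv_cong[OF _ eqv_refl])

lemma rewrite_left:
  "E; G \<turnstile> Eq a s t \<Longrightarrow> E; G \<turnstile> Eq a s u \<Longrightarrow> E; G \<turnstile> Eq a t u"
  by (blast intro: eqv_sym eqv_trans)


section \<open>Contraction of abstractions\<close>

lemmas comb_K = derivable.Arith[OF ha_axiom.comb_K[unfolded has_sort_iff]]
lemmas comb_S = derivable.Arith[OF ha_axiom.comb_S[unfolded has_sort_iff]]
lemmas recN_zero = derivable.Arith[OF ha_axiom.recN_zero[unfolded has_sort_iff]]
lemmas recN_suc = derivable.Arith[OF ha_axiom.recN_suc[unfolded has_sort_iff]]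
lemmas recSeq_empty = derivable.Arith[OF ha_axiom.recSeq_empty[unfolded has_sort_iff]]
lemmas recSeq_snoc = derivable.Arith[OF ha_axiom.recSeq_snoc[unfolded has_sort_iff]]
lemmas cond_0 = derivable.Arith[OF ha_axiom.cond_0[unfolded has_sort_iff]]
lemmas cond_1 = derivable.Arith[OF ha_axiom.cond_1[unfolded has_sort_iff]]

text \<open>Equality is intensional, so an abstraction contracts only once applied. The substitution
  holds the arguments already supplied to outer abstractions, which lets nested ones contract one at
  a time.\<close>

lemma beta:
  assumes "srt (map Ty (a # V)) t = Some (Ty b)" "srt E x = Some (Ty a)"
    and "\<And>n. n < length V \<Longrightarrow> srt E (\<sigma> n) = Some (Ty (V ! n))"
  shows "E; G \<turnstile> Eq b (tsubst \<sigma> (lam V a t) \<bullet> x) (tsubst (case_nat x \<sigma>) t)"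
  using assms
proof (induction V a t arbitrary: b rule: lam.induct)
  case (1 V a)
  then have [simp]: "b = a" by simp
  have "E; G \<turnstile> Eq a (Con (CS a (a \<rightharpoondown> a) a) \<bullet> Con (CK a (a \<rightharpoondown> a)) \<bullet> Con (CK a a) \<bullet> x)
      (Con (CK a (a \<rightharpoondown> a)) \<bullet> x \<bullet> (Con (CK a a) \<bullet> x))"
    by (rule comb_S) (use 1 in auto)
  also have "E; G \<turnstile> Eq a (Con (CK a (a \<rightharpoondown> a)) \<bullet> x \<bullet> (Con (CK a a) \<bullet> x)) x"
    by (rule comb_K) (use 1 in auto)
  finally show ?case by (simp add: lam.simps)
next
  case (2 V a n)
  then show ?case by (auto simp: lam.simps intro!: comb_K split: if_splits)
next
  case (3 V a c)
  then show ?case by (auto simp: lam.simps intro!: comb_K)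
next
  case (4 V a s t)
  from 4(3) obtain c where c: "srt (map Ty (a # V)) s = Some (Ty (c \<rightharpoondown> b))"
    "srt (map Ty (a # V)) t = Some (Ty c)" by (rule srt_App_cases) auto
  have sub: "srt E (tsubst \<sigma> (lam V a u)) = Some (Ty (a \<rightharpoondown> d))"
    if "srt (map Ty (a # V)) u = Some (Ty d)" for u d
    by (rule srt_tsubst[OF srt_lam[OF that]]) (use 4(5) in auto)
  have "E; G \<turnstile> Eq b (Con (CS a c b) \<bullet> tsubst \<sigma> (lam V a s) \<bullet> tsubst \<sigma> (lam V a t) \<bullet> x)
      (tsubst \<sigma> (lam V a s) \<bullet> x \<bullet> (tsubst \<sigma> (lam V a t) \<bullet> x))"
    by (rule comb_S) (use 4(4) sub c in auto)
  also have "E; G \<turnstile> Eq b (tsubst \<sigma> (lam V a s) \<bullet> x \<bullet> (tsubst \<sigma> (lam V a t) \<bullet> x))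
      (tsubst (case_nat x \<sigma>) s \<bullet> tsubst (case_nat x \<sigma>) t)"
    by (rule eqv_cong) (use 4 c in blast)+
  finally show ?case using tyof_eq[OF c(1)] tyof_eq[OF c(2)] by (simp add: lam.simps)
qed

lemma beta2:
  assumes "srt [Ty b, Ty a] t = Some (Ty r)" "srt E x = Some (Ty a)" "srt E y = Some (Ty b)"
  shows "E; G \<turnstile> Eq r (lam [] a (lam [a] b t) \<bullet> x \<bullet> y) (tsubst (case_nat y (case_nat x Var)) t)"
proof -
  have t1: "srt [Ty a] (lam [a] b t) = Some (Ty (b \<rightharpoondown> r))"
    using srt_lam[of b "[a]"] assms(1) by simp
  have 1: "E; G \<turnstile> Eq (b \<rightharpoondown> r) (lam [] a (lam [a] b t) \<bullet> x) (tsubst (case_nat x Var) (lam [a] b t))"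
    using beta[of a "[]" "lam [a] b t" "b \<rightharpoondown> r" E x Var] t1 assms(2) by simp
  have 2: "E; G \<turnstile> Eq r (tsubst (case_nat x Var) (lam [a] b t) \<bullet> y) (tsubst (case_nat y (case_nat x Var)) t)"
    by (rule beta) (use assms in auto)
  show ?thesis by (rule eqv_trans[OF eqv_cong_fun[OF 1 assms(3)] 2])
qed

lemma beta3:
  assumes "srt [Ty c, Ty b, Ty a] t = Some (Ty r)"
    and "srt E x = Some (Ty a)" "srt E y = Some (Ty b)" "srt E z = Some (Ty c)"
  shows "E; G \<turnstile> Eq r (lam [] a (lam [a] b (lam [b, a] c t)) \<bullet> x \<bullet> y \<bullet> z)
    (tsubst (case_nat z (case_nat y (case_nat x Var))) t)"
proof -
  have t1: "srt [Ty b, Ty a] (lam [b, a] c t) = Some (Ty (c \<rightharpoondown> r))"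
    using srt_lam[of c "[b, a]"] assms(1) by simp
  have 1: "E; G \<turnstile> Eq r (tsubst (case_nat y (case_nat x Var)) (lam [b, a] c t) \<bullet> z)
      (tsubst (case_nat z (case_nat y (case_nat x Var))) t)"
    by (rule beta) (use assms in \<open>auto simp: less_Suc_eq\<close>)
  show ?thesis by (rule eqv_trans[OF eqv_cong_fun[OF beta2[OF t1 assms(2,3)] assms(4)] 1])
qed

lemma beta4:
  assumes "srt [Ty d, Ty c, Ty b, Ty a] t = Some (Ty r)"
    and "srt E x = Some (Ty a)" "srt E y = Some (Ty b)" "srt E z = Some (Ty c)" "srt E w = Some (Ty d)"
  shows "E; G \<turnstile> Eq r (lam [] a (lam [a] b (lam [b, a] c (lam [c, b, a] d t))) \<bullet> x \<bullet> y \<bullet> z \<bullet> w)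
    (tsubst (case_nat w (case_nat z (case_nat y (case_nat x Var)))) t)"
proof -
  have t1: "srt [Ty c, Ty b, Ty a] (lam [c, b, a] d t) = Some (Ty (d \<rightharpoondown> r))"
    using srt_lam[of d "[c, b, a]"] assms(1) by simp
  have 1: "E; G \<turnstile> Eq r (tsubst (case_nat z (case_nat y (case_nat x Var))) (lam [c, b, a] d t) \<bullet> w)
      (tsubst (case_nat w (case_nat z (case_nat y (case_nat x Var)))) t)"
    by (rule beta) (use assms in \<open>auto simp: less_Suc_eq\<close>)
  show ?thesis by (rule eqv_trans[OF eqv_cong_fun[OF beta3[OF t1 assms(2,3,4)] assms(5)] 1])
qed

section \<open>Induction rules and booleans\<close>

lemma nat_induct_rule:
  assumes "E; G \<turnstile> inst zero A"
    and "Ty TN # E; insert A (lift ` G) \<turnstile> subst (case_nat (suc (Var 0)) (\<lambda>n. Var (Suc n))) A"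
    and "wf_fm (Ty TN # E) A"
  shows "E; G \<turnstile> All (Ty TN) A"
  by (rule derivable.ImpE[OF derivable.ImpE[OF derivable.Arith[OF ha_axiom.ind_N]]])
    (use assms in \<open>auto intro!: derivable.AllI derivable.ImpI\<close>)

text \<open>The step introduces two variables, the bit at 0 and the sequence at 1, so the hypothesis
  about the sequence is lifted past the bit.\<close>

lemma seq_induct_rule:
  assumes "E; G \<turnstile> inst nil A"
    and "Ty TB # Ty TSeq # E; insert (lift A) (lift ` lift ` G) \<turnstile>
      subst (case_nat (snoc (Var 0) (Var 1)) (\<lambda>n. Var (n + 2))) A"
    and "wf_fm (Ty TSeq # E) A"
  shows "E; G \<turnstile> All (Ty TSeq) A"
  by (rule derivable.ImpE[OF derivable.ImpE[OF derivable.Arith[OF ha_axiom.ind_Seq]]])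
    (use assms in \<open>auto intro!: derivable.AllI derivable.ImpI\<close>)

text \<open>Boolean induction proves that every bit is 0 or 1; this justifies case distinctions on
  bits in the intuitionistic calculus.\<close>

lemma bool_cases:
  assumes "srt E b = Some (Ty TB)"
    and "E; insert (Eq TB b b0) G \<turnstile> C" "E; insert (Eq TB b b1) G \<turnstile> C"
  shows "E; G \<turnstile> C"
proof -
  let ?A = "Or (Eq TB (Var 0) b0) (Eq TB (Var 0) b1)"
  have "E; G \<turnstile> All (Ty TB) ?A"
    by (rule derivable.ImpE[OF derivable.ImpE[OF derivable.Arith[OF ha_axiom.ind_B]]])
      (simp_all add: inst_def derivable.OrI1 derivable.OrI2 eqv_refl)
  then have "E; G \<turnstile> Or (Eq TB b b0) (Eq TB b b1)"
    by (rule all_elim) (use assms(1) in \<open>auto simp: inst_def\<close>)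
  then show ?thesis using assms(2,3) by (rule derivable.OrE)
qed

lemma b0_neq_b1:
  assumes "E; G \<turnstile> Eq TB b b0" "E; G \<turnstile> Eq TB b b1" "wf_fm E C"
  shows "E; G \<turnstile> C"
proof -
  \<comment> \<open>No axiom separates the bits directly; a conditional with values 0 and 1 would
    identify zero with a successor.\<close>
  let ?c = "\<lambda>b. cond TN zero (suc zero) b"
  have "E; G \<turnstile> Eq TN zero (?c b0)" by (rule eqv_sym, rule cond_0) auto
  also have "E; G \<turnstile> Eq TN (?c b0) (?c b1)"
    by (rule eqv_cong_arg[OF rewrite_left[OF assms(1,2)]]) simp
  also have "E; G \<turnstile> Eq TN (?c b1) (suc zero)" by (rule cond_1) auto
  finally have "E; G \<turnstile> Eq TN zero (suc zero)" .
  then have "E; G \<turnstile> Bot"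
    by (rule derivable.ImpE[OF derivable.Arith[OF ha_axiom.zero_not_suc], rotated]) simp
  then show ?thesis using assms(3) by (rule derivable.BotE)
qed

lemma bor_1:
  assumes "E; G \<turnstile> Eq TB x b1" "srt E y = Some (Ty TB)"
  shows "E; G \<turnstile> Eq TB (bor x y) b1"
proof -
  have "E; G \<turnstile> Eq TB (bor x y) (bor b1 y)" by (rule eqv_cong_arg[OF assms(1)]) (use assms in simp)
  also have "E; G \<turnstile> Eq TB (bor b1 y) b1" by (rule cond_1) (use assms in simp_all)
  finally show ?thesis .
qed

lemma bor_0:
  assumes "E; G \<turnstile> Eq TB x b0" "srt E y = Some (Ty TB)"
  shows "E; G \<turnstile> Eq TB (bor x y) y"
proof -
  have "E; G \<turnstile> Eq TB (bor x y) (bor b0 y)" by (rule eqv_cong_arg[OF assms(1)]) (use assms in simp)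
  also have "E; G \<turnstile> Eq TB (bor b0 y) y" by (rule cond_0) (use assms in simp_all)
  finally show ?thesis .
qed

text \<open>\<open>bor\<close> computes by its first argument only, hence the case distinction on
  \<open>x\<close>.\<close>

lemma bor_2:
  assumes "E; G \<turnstile> Eq TB y b1" "srt E x = Some (Ty TB)"
  shows "E; G \<turnstile> Eq TB (bor x y) b1"
proof (rule bool_cases[OF assms(2)])
  have y: "srt E y = Some (Ty TB)" using entails_wf[OF assms(1)] by simp
  show "E; insert (Eq TB x b0) G \<turnstile> Eq TB (bor x y) b1"
    by (rule eqv_trans[OF bor_0 weaken_insert[OF assms(1)]], rule hyp) (use assms(2) y in simp_all)
  show "E; insert (Eq TB x b1) G \<turnstile> Eq TB (bor x y) b1"
    by (rule bor_1, rule hyp) (use assms(2) y in simp_all)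
qed

lemma bor_E:
  assumes "E; G \<turnstile> Eq TB (bor x y) b1" "srt E x = Some (Ty TB)" "srt E y = Some (Ty TB)"
    and "E; insert (Eq TB x b1) G \<turnstile> C" "E; insert (Eq TB y b1) G \<turnstile> C"
  shows "E; G \<turnstile> C"
proof (rule bool_cases[OF assms(2) _ assms(4)])
  let ?H = "insert (Eq TB x b0) G"
  have "E; ?H \<turnstile> Eq TB y b1"
    by (rule rewrite_left[OF bor_0 weaken_insert[OF assms(1)]], rule hyp) (use assms in simp_all)
  moreover have "E; insert (Eq TB y b1) ?H \<turnstile> C" by (rule weaken[OF assms(5)]) auto
  ultimately show "E; ?H \<turnstile> C" by (rule cut)
qed

lemma band_1:
  assumes "E; G \<turnstile> Eq TB x b1" "srt E y = Some (Ty TB)"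
  shows "E; G \<turnstile> Eq TB (band x y) y"
proof -
  have "E; G \<turnstile> Eq TB (band x y) (band b1 y)" by (rule eqv_cong_arg[OF assms(1)]) (use assms in simp)
  also have "E; G \<turnstile> Eq TB (band b1 y) y" by (rule cond_1) (use assms in simp_all)
  finally show ?thesis .
qed

lemma band_0:
  assumes "E; G \<turnstile> Eq TB x b0" "srt E y = Some (Ty TB)"
  shows "E; G \<turnstile> Eq TB (band x y) b0"
proof -
  have "E; G \<turnstile> Eq TB (band x y) (band b0 y)" by (rule eqv_cong_arg[OF assms(1)]) (use assms in simp)
  also have "E; G \<turnstile> Eq TB (band b0 y) b0" by (rule cond_0) (use assms in simp_all)
  finally show ?thesis .
qed

lemma band_E:
  assumes "E; G \<turnstile> Eq TB (band x y) b1" "srt E x = Some (Ty TB)" "srt E y = Some (Ty TB)"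
    and "E; insert (Eq TB x b1) (insert (Eq TB y b1) G) \<turnstile> C"
  shows "E; G \<turnstile> C"
proof (rule bool_cases[OF assms(2)])
  show "E; insert (Eq TB x b0) G \<turnstile> C"
    by (rule b0_neq_b1[OF band_0 weaken_insert[OF assms(1)]], rule hyp)
      (use assms entails_wf[OF assms(4)] in simp_all)
  have "E; insert (Eq TB x b1) G \<turnstile> Eq TB y b1"
    by (rule rewrite_left[OF band_1 weaken_insert[OF assms(1)]], rule hyp) (use assms in simp_all)
  then show "E; insert (Eq TB x b1) G \<turnstile> C"
    by (rule cut) (use assms(4) in \<open>simp add: insert_commute\<close>)
qed

section \<open>Arithmetic and correctness of the numbering\<close>

lemma add_zero: "srt E n = Some (Ty TN) \<Longrightarrow> E; G \<turnstile> Eq TN (add n zero) n"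
  by (rule recN_zero) simp_all

lemma add_suc:
  assumes "srt E n = Some (Ty TN)" "srt E m = Some (Ty TN)"
  shows "E; G \<turnstile> Eq TN (add n (suc m)) (suc (add n m))"
proof -
  have step: "E; G \<turnstile> Eq TN (add_step \<bullet> x \<bullet> y) (suc y)"
    if "srt E x = Some (Ty TN)" "srt E y = Some (Ty TN)" for x y
    using beta2[of TN TN "suc (Var 0)" TN E x y G] that by (simp add: add_step_def)
  show ?thesis by (rule eqv_trans[OF recN_suc step]) (use assms in simp_all)
qed

lemma dbl_zero: "E; G \<turnstile> Eq TN (dbl zero) zero"
  by (rule recN_zero) simp_all

lemma dbl_suc:
  assumes "srt E n = Some (Ty TN)"
  shows "E; G \<turnstile> Eq TN (dbl (suc n)) (suc (suc (dbl n)))"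
proof -
  have step: "E; G \<turnstile> Eq TN (dbl_step \<bullet> x \<bullet> y) (suc (suc y))"
    if "srt E x = Some (Ty TN)" "srt E y = Some (Ty TN)" for x y
    using beta2[of TN TN "suc (suc (Var 0))" TN E x y G] that by (simp add: dbl_step_def)
  show ?thesis by (rule eqv_trans[OF recN_suc step]) (use assms in simp_all)
qed

lemma inc_step:
  assumes "srt E b = Some (Ty TB)" "srt E u = Some (Ty TSeq)" "srt E v = Some (Ty TSeq)"
  shows "E; G \<turnstile> Eq TSeq (inc_step \<bullet> b \<bullet> u \<bullet> v) (cond TSeq (snoc b1 u) (snoc b0 v) b)"
  using beta3[of TSeq TSeq TB "cond TSeq (snoc b1 (Var 1)) (snoc b0 (Var 0)) (Var 2)" TSeq E b u v G]
    assms by (simp add: inc_step_def)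

lemma inc_nil: "E; G \<turnstile> Eq TSeq (inc nil) (snoc b0 nil)"
  by (rule recSeq_empty) simp_all

lemma inc_snoc0:
  assumes "srt E u = Some (Ty TSeq)"
  shows "E; G \<turnstile> Eq TSeq (inc (snoc b0 u)) (snoc b1 u)"
  by (rule eqv_trans[OF recSeq_snoc eqv_trans[OF inc_step cond_0]]) (use assms in simp_all)

lemma inc_snoc1:
  assumes "srt E u = Some (Ty TSeq)"
  shows "E; G \<turnstile> Eq TSeq (inc (snoc b1 u)) (snoc b0 (inc u))"
  by (rule eqv_trans[OF recSeq_snoc eqv_trans[OF inc_step cond_1]]) (use assms in simp_all)

lemma dec_zero: "E; G \<turnstile> Eq TSeq (dec zero) nil"
  by (rule recN_zero) simp_all

lemma dec_suc:
  assumes "srt E n = Some (Ty TN)"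
  shows "E; G \<turnstile> Eq TSeq (dec (suc n)) (inc (dec n))"
proof -
  have step: "E; G \<turnstile> Eq TSeq (dec_step \<bullet> x \<bullet> y) (inc y)"
    if "srt E x = Some (Ty TN)" "srt E y = Some (Ty TSeq)" for x y
    using beta2[of TSeq TN "inc (Var 0)" TSeq E x y G] that by (simp add: dec_step_def)
  show ?thesis by (rule eqv_trans[OF recN_suc step]) (use assms in simp_all)
qed

text \<open>The equation for the odd number is a premise, so that this serves both inside the
  induction for \<open>dec_dbl1\<close> and after it.\<close>

lemma dec_dbl2_aux:
  assumes "srt E n = Some (Ty TN)" "E; G \<turnstile> Eq TSeq (dec (suc (dbl n))) (snoc b0 (dec n))"
  shows "E; G \<turnstile> Eq TSeq (dec (suc (suc (dbl n)))) (snoc b1 (dec n))"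
  by (rule eqv_trans[OF dec_suc eqv_trans[OF eqv_cong_arg[OF assms(2)] inc_snoc0]])
    (use assms(1) in simp_all)

text \<open>Induction on \<open>n\<close>: two increments turn a final 0 into 1 and then into 0 with
  a carry, so the sequence in front advances by one.\<close>

lemma dec_dbl1:
  assumes "srt E n = Some (Ty TN)"
  shows "E; G \<turnstile> Eq TSeq (dec (suc (dbl n))) (snoc b0 (dec n))"
proof -
  let ?A = "Eq TSeq (dec (suc (dbl (Var 0)))) (snoc b0 (dec (Var 0)))"
  have "E; G \<turnstile> All (Ty TN) ?A"
  proof (rule nat_induct_rule)
    have "E; G \<turnstile> Eq TSeq (dec (suc (dbl zero))) (dec (suc zero))"
      by (rule eqv_cong_arg[OF eqv_cong_arg[OF dbl_zero]]) simp_all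
    also have "E; G \<turnstile> Eq TSeq (dec (suc zero)) (inc (dec zero))" by (rule dec_suc) simp
    also have "E; G \<turnstile> Eq TSeq (inc (dec zero)) (inc nil)"
      by (rule eqv_cong_arg[OF dec_zero]) simp
    also have "E; G \<turnstile> Eq TSeq (inc nil) (snoc b0 nil)" by (rule inc_nil)
    also have "E; G \<turnstile> Eq TSeq (snoc b0 nil) (snoc b0 (dec zero))"
      by (rule eqv_cong_arg[OF eqv_sym[OF dec_zero]]) simp
    finally show "E; G \<turnstile> inst zero ?A" by (simp add: inst_def)
  next
    let ?E = "Ty TN # E" and ?G = "insert ?A (lift ` G)" and ?n = "Var 0"
    have "?E; ?G \<turnstile> Eq TSeq (dec (suc (dbl (suc ?n)))) (dec (suc (suc (suc (dbl ?n)))))"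
      by (rule eqv_cong_arg[OF eqv_cong_arg[OF dbl_suc]]) simp_all
    also have "?E; ?G \<turnstile> Eq TSeq (dec (suc (suc (suc (dbl ?n))))) (inc (dec (suc (suc (dbl ?n)))))"
      by (rule dec_suc) simp
    also have "?E; ?G \<turnstile> Eq TSeq (inc (dec (suc (suc (dbl ?n))))) (inc (snoc b1 (dec ?n)))"
      by (rule eqv_cong_arg[OF dec_dbl2_aux[OF _ hyp]]) simp_all
    also have "?E; ?G \<turnstile> Eq TSeq (inc (snoc b1 (dec ?n))) (snoc b0 (inc (dec ?n)))"
      by (rule inc_snoc1) simp
    also have "?E; ?G \<turnstile> Eq TSeq (snoc b0 (inc (dec ?n))) (snoc b0 (dec (suc ?n)))"
      by (rule eqv_cong_arg[OF eqv_sym[OF dec_suc]]) simp_all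
    finally show "?E; ?G \<turnstile> subst (case_nat (suc (Var 0)) (\<lambda>n. Var (Suc n))) ?A" by simp
  qed simp
  then show ?thesis by (rule all_elim) (use assms in \<open>simp_all add: inst_def\<close>)
qed

lemmas dec_dbl2 = dec_dbl2_aux[OF _ dec_dbl1]

lemma enc_snoc:
  assumes "srt E b = Some (Ty TB)" "srt E u = Some (Ty TSeq)"
  shows "E; G \<turnstile> Eq TN (enc (snoc b u)) (cond TN (suc (dbl (enc u))) (suc (suc (dbl (enc u)))) b)"
proof -
  have step: "E; G \<turnstile> Eq TN (enc_step \<bullet> b \<bullet> u \<bullet> v) (cond TN (suc (dbl v)) (suc (suc (dbl v))) b)"
    if "srt E v = Some (Ty TN)" for v
    using beta3[of TN TSeq TB "cond TN (suc (dbl (Var 0))) (suc (suc (dbl (Var 0)))) (Var 2)" TN E b u v G]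
      that assms by (simp add: enc_step_def)
  show ?thesis by (rule eqv_trans[OF recSeq_snoc step]) (use assms in simp_all)
qed

text \<open>Induction on \<open>u\<close>: a final 0 has an odd code and a final 1 an even one,
  which is how \<open>dec_dbl1\<close> and \<open>dec_dbl2\<close> read the last bit back.\<close>

lemma dec_enc:
  assumes "srt E u = Some (Ty TSeq)"
  shows "E; G \<turnstile> Eq TSeq (dec (enc u)) u"
proof -
  let ?A = "Eq TSeq (dec (enc (Var 0))) (Var 0)"
  have "E; G \<turnstile> All (Ty TSeq) ?A"
  proof (rule seq_induct_rule)
    have "E; G \<turnstile> Eq TN (enc nil) zero" by (rule recSeq_empty) simp_all
    then have "E; G \<turnstile> Eq TSeq (dec (enc nil)) nil"
      by (rule eqv_trans[OF eqv_cong_arg dec_zero]) simp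
    then show "E; G \<turnstile> inst nil ?A" by (simp add: inst_def)
  next
    let ?E = "Ty TB # Ty TSeq # E" and ?G = "insert (lift ?A) (lift ` lift ` G)"
    let ?u = "Var 1" and ?b = "Var 0"
    have "?E; ?G \<turnstile> Eq TSeq (dec (enc (snoc ?b ?u))) (snoc ?b ?u)"
    proof (rule bool_cases[of _ ?b])
      let ?H = "insert (Eq TB ?b b0) ?G"
      have "?E; ?H \<turnstile> Eq TSeq (dec (enc (snoc ?b ?u))) (dec (enc (snoc b0 ?u)))"
        by (rule eqv_cong_arg[OF eqv_cong_arg[OF eqv_cong_fun[OF eqv_cong_arg[OF hyp]]]]) simp_all
      also have "?E; ?H \<turnstile> Eq TSeq (dec (enc (snoc b0 ?u))) (dec (suc (dbl (enc ?u))))"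
        by (rule eqv_cong_arg[OF eqv_trans[OF enc_snoc cond_0]]) simp_all
      also have "?E; ?H \<turnstile> Eq TSeq (dec (suc (dbl (enc ?u)))) (snoc b0 (dec (enc ?u)))"
        by (rule dec_dbl1) simp
      also have "?E; ?H \<turnstile> Eq TSeq (snoc b0 (dec (enc ?u))) (snoc ?b ?u)"
        by (rule eqv_cong[OF eqv_cong_arg[OF eqv_sym[OF hyp]] weaken_insert[OF derivable.Hyp]]) simp_all
      finally show "?E; ?H \<turnstile> Eq TSeq (dec (enc (snoc ?b ?u))) (snoc ?b ?u)" .
    next
      let ?H = "insert (Eq TB ?b b1) ?G"
      have "?E; ?H \<turnstile> Eq TSeq (dec (enc (snoc ?b ?u))) (dec (enc (snoc b1 ?u)))"
        by (rule eqv_cong_arg[OF eqv_cong_arg[OF eqv_cong_fun[OF eqv_cong_arg[OF hyp]]]]) simp_all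
      also have "?E; ?H \<turnstile> Eq TSeq (dec (enc (snoc b1 ?u))) (dec (suc (suc (dbl (enc ?u)))))"
        by (rule eqv_cong_arg[OF eqv_trans[OF enc_snoc cond_1]]) simp_all
      also have "?E; ?H \<turnstile> Eq TSeq (dec (suc (suc (dbl (enc ?u))))) (snoc b1 (dec (enc ?u)))"
        by (rule dec_dbl2) simp_all
      also have "?E; ?H \<turnstile> Eq TSeq (snoc b1 (dec (enc ?u))) (snoc ?b ?u)"
        by (rule eqv_cong[OF eqv_cong_arg[OF eqv_sym[OF hyp]] weaken_insert[OF derivable.Hyp]]) simp_all
      finally show "?E; ?H \<turnstile> Eq TSeq (dec (enc (snoc ?b ?u))) (snoc ?b ?u)" .
    qed simp
    then show "?E; ?G \<turnstile> subst (case_nat (snoc (Var 0) (Var 1)) (\<lambda>n. Var (n + 2))) ?A" by simp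
  qed simp
  then show ?thesis by (rule all_elim) (use assms in \<open>simp_all add: inst_def\<close>)
qed

section \<open>The equality test\<close>

lemma eqn_zero:
  assumes "srt E m = Some (Ty TN)"
  shows "E; G \<turnstile> Eq TB (eqn zero m) (recN TB b1 const0 m)"
  by (rule eqv_cong_fun[OF recN_zero]) (use assms in simp_all)

lemma eqn_suc:
  assumes "srt E n = Some (Ty TN)" "srt E m = Some (Ty TN)"
  shows "E; G \<turnstile> Eq TB (eqn (suc n) m)
    (recN TB b0 (peel \<bullet> recN cantor (Con (CRecN TB) \<bullet> b1 \<bullet> const0) eqn_step n) m)"
proof -
  have step: "E; G \<turnstile> Eq TB (eqn_step \<bullet> n \<bullet> r \<bullet> m) (recN TB b0 (peel \<bullet> r) m)"
    if "srt E r = Some (Ty cantor)" for r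
    using beta3[of TN cantor TN "recN TB b0 (peel \<bullet> Var 1) (Var 0)" TB E n r m G]
      that assms by (simp add: eqn_step_def)
  show ?thesis
    by (rule eqv_trans[OF eqv_cong_fun[OF recN_suc] step]) (use assms in simp_all)
qed

lemma eqn_zero_zero: "E; G \<turnstile> Eq TB (eqn zero zero) b1"
  by (rule eqv_trans[OF eqn_zero recN_zero]) simp_all

lemma eqn_zero_suc:
  assumes "srt E m = Some (Ty TN)"
  shows "E; G \<turnstile> Eq TB (eqn zero (suc m)) b0"
proof -
  have step: "E; G \<turnstile> Eq TB (const0 \<bullet> x \<bullet> y) b0"
    if "srt E x = Some (Ty TN)" "srt E y = Some (Ty TB)" for x y
    using beta2[of TB TN b0 TB E x y G] that by (simp add: const0_def)
  show ?thesis by (rule eqv_trans[OF eqn_zero eqv_trans[OF recN_suc step]]) (use assms in simp_all)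
qed

lemma eqn_suc_zero:
  assumes "srt E n = Some (Ty TN)"
  shows "E; G \<turnstile> Eq TB (eqn (suc n) zero) b0"
  by (rule eqv_trans[OF eqn_suc recN_zero]) (use assms in simp_all)

lemma eqn_suc_suc:
  assumes "srt E n = Some (Ty TN)" "srt E m = Some (Ty TN)"
  shows "E; G \<turnstile> Eq TB (eqn (suc n) (suc m)) (eqn n m)"
proof -
  have step: "E; G \<turnstile> Eq TB (peel \<bullet> x \<bullet> y \<bullet> z) (x \<bullet> y)"
    if "srt E x = Some (Ty cantor)" "srt E y = Some (Ty TN)" "srt E z = Some (Ty TB)" for x y z
    using beta3[of TB TN cantor "Var 2 \<bullet> Var 1" TB E x y z G] that by (simp add: peel_def)
  show ?thesis by (rule eqv_trans[OF eqn_suc eqv_trans[OF recN_suc step]]) (use assms in simp_all)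
qed

lemma eqn_refl:
  assumes "srt E n = Some (Ty TN)"
  shows "E; G \<turnstile> Eq TB (eqn n n) b1"
proof -
  have "E; G \<turnstile> All (Ty TN) (Eq TB (eqn (Var 0) (Var 0)) b1)" (is "E; G \<turnstile> All _ ?A")
  proof (rule nat_induct_rule)
    show "E; G \<turnstile> inst zero ?A" by (simp add: inst_def eqn_zero_zero)
    have "Ty TN # E; insert ?A (lift ` G) \<turnstile> Eq TB (eqn (suc (Var 0)) (suc (Var 0))) b1"
      by (rule eqv_trans[OF eqn_suc_suc hyp]) simp_all
    then show "Ty TN # E; insert ?A (lift ` G) \<turnstile> subst (case_nat (suc (Var 0)) (\<lambda>n. Var (Suc n))) ?A"
      by simp
  qed simp
  then show ?thesis by (rule all_elim) (use assms in \<open>simp_all add: inst_def\<close>)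
qed

lemma eqn_sound:
  assumes "E; G \<turnstile> Eq TB (eqn n m) b1" "srt E n = Some (Ty TN)" "srt E m = Some (Ty TN)"
  shows "E; G \<turnstile> Eq TN n m"
proof -
  let ?F = "\<lambda>n. Imp (Eq TB (eqn n (Var 0)) b1) (Eq TN n (Var 0))"
  \<comment> \<open>The second number is quantified inside the induction on the first, since the
    step passes to both predecessors.\<close>
  let ?A = "All (Ty TN) (?F (Var 1))"
  have "E; G \<turnstile> All (Ty TN) ?A"
  proof (rule nat_induct_rule)
    have "E; G \<turnstile> All (Ty TN) (?F zero)"
    proof (rule nat_induct_rule)
      show "E; G \<turnstile> inst zero (?F zero)"
        by (simp add: inst_def derivable.ImpI eqv_refl)
      let ?H = "Eq TB (eqn zero (suc (Var 0))) b1"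
      have "Ty TN # E; insert ?H (insert (?F zero) (lift ` G)) \<turnstile> Eq TN zero (suc (Var 0))"
        by (rule b0_neq_b1[OF eqn_zero_suc hyp]) simp_all
      then show "Ty TN # E; insert (?F zero) (lift ` G) \<turnstile>
          subst (case_nat (suc (Var 0)) (\<lambda>n. Var (Suc n))) (?F zero)"
        by (simp add: derivable.ImpI)
    qed simp
    then show "E; G \<turnstile> inst zero ?A" by (simp add: inst_def)
  next
    let ?E = "Ty TN # E" and ?G = "insert ?A (lift ` G)"
    have "?E; ?G \<turnstile> All (Ty TN) (?F (suc (Var 1)))"
    proof (rule nat_induct_rule)
      have "?E; insert (Eq TB (eqn (suc (Var 0)) zero) b1) ?G \<turnstile> Eq TN (suc (Var 0)) zero"
        by (rule b0_neq_b1[OF eqn_suc_zero hyp]) simp_all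
      then show "?E; ?G \<turnstile> inst zero (?F (suc (Var 1)))"
        by (simp add: inst_def derivable.ImpI)
      let ?H = "insert (Eq TB (eqn (suc (Var 1)) (suc (Var 0))) b1)
        (insert (?F (suc (Var 1))) (lift ` ?G))"
      \<comment> \<open>The inner induction distinguishes zero from successors; for successors the
        outer hypothesis is applied to the predecessors.\<close>
      have "Ty TN # ?E; ?H \<turnstile> lift ?A" by (rule derivable.Hyp) simp_all
      then have "Ty TN # ?E; ?H \<turnstile> Imp (Eq TB (eqn (Var 1) (Var 0)) b1) (Eq TN (Var 1) (Var 0))"
        unfolding subst.simps by (rule all_elim) (simp_all add: inst_def)
      moreover have "Ty TN # ?E; ?H \<turnstile> Eq TB (eqn (Var 1) (Var 0)) b1"
        by (rule rewrite_left[OF eqn_suc_suc hyp]) simp_all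
      ultimately have "Ty TN # ?E; ?H \<turnstile> Eq TN (Var 1) (Var 0)" by (rule derivable.ImpE)
      then have "Ty TN # ?E; ?H \<turnstile> Eq TN (suc (Var 1)) (suc (Var 0))" by (rule eqv_cong_arg) simp
      then show "Ty TN # ?E; insert (?F (suc (Var 1))) (lift ` ?G) \<turnstile>
          subst (case_nat (suc (Var 0)) (\<lambda>n. Var (Suc n))) (?F (suc (Var 1)))"
        by (simp add: derivable.ImpI)
    qed simp
    then show "?E; ?G \<turnstile> subst (case_nat (suc (Var 0)) (\<lambda>n. Var (Suc n))) ?A" by simp
  qed simp
  then have "E; G \<turnstile> All (Ty TN) (?F (tlift n))" by (rule all_elim) (use assms in \<open>simp_all add: inst_def\<close>)
  then have "E; G \<turnstile> Imp (Eq TB (eqn n m) b1) (Eq TN n m)"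
    by (rule all_elim) (use assms in \<open>simp_all add: inst_def\<close>)
  then show ?thesis using assms(1) by (rule derivable.ImpE)
qed

lemma enc_inj:
  assumes "E; G \<turnstile> Eq TN (enc u) (enc v)" "srt E u = Some (Ty TSeq)" "srt E v = Some (Ty TSeq)"
  shows "E; G \<turnstile> Eq TSeq u v"
proof -
  have "E; G \<turnstile> Eq TSeq (dec (enc u)) (dec (enc v))" by (rule eqv_cong_arg[OF assms(1)]) simp
  then have "E; G \<turnstile> Eq TSeq u (dec (enc v))" by (rule rewrite_left[OF dec_enc[OF assms(2)]])
  then show ?thesis by (rule eqv_trans) (rule dec_enc[OF assms(3)])
qed

section \<open>Covering stages\<close>

lemma cov_zero:
  assumes "srt E p = Some (Ty (TN \<rightharpoondown> TSeq))" "srt E u = Some (Ty TSeq)"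
  shows "E; G \<turnstile> Eq TB (cov p zero u) b0"
  by (rule eqv_trans[OF eqv_cong_fun[OF recN_zero] comb_K]) (use assms in simp_all)

lemma cov_suc:
  assumes "srt E p = Some (Ty (TN \<rightharpoondown> TSeq))" "srt E n = Some (Ty TN)" "srt E u = Some (Ty TSeq)"
  shows "E; G \<turnstile> Eq TB (cov p (suc n) u)
    (bor (cov p n u) (bor (eqn (enc u) (enc (p \<bullet> n))) (band (cov p n (snoc b0 u)) (cov p n (snoc b1 u)))))"
proof -
  have step: "E; G \<turnstile> Eq TB (cov_step \<bullet> p \<bullet> n \<bullet> r \<bullet> u)
      (bor (r \<bullet> u) (bor (eqn (enc u) (enc (p \<bullet> n))) (band (r \<bullet> snoc b0 u) (r \<bullet> snoc b1 u))))"
    if "srt E r = Some (Ty (TSeq \<rightharpoondown> TB))" for r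
    using beta4[of TSeq "TSeq \<rightharpoondown> TB" TN "TN \<rightharpoondown> TSeq"
        "bor (Var 1 \<bullet> Var 0) (bor (eqn (enc (Var 0)) (enc (Var 3 \<bullet> Var 2)))
           (band (Var 1 \<bullet> snoc b0 (Var 0)) (Var 1 \<bullet> snoc b1 (Var 0))))" TB E p n r u G]
      that assms by (simp add: cov_step_def)
  show ?thesis
    by (rule eqv_trans[OF eqv_cong_fun[OF recN_suc] step]) (use assms in simp_all)
qed

lemma cov_mono:
  assumes "E; G \<turnstile> Eq TB (cov p n u) b1"
    and "srt E p = Some (Ty (TN \<rightharpoondown> TSeq))" "srt E n = Some (Ty TN)" "srt E u = Some (Ty TSeq)"
  shows "E; G \<turnstile> Eq TB (cov p (suc n) u) b1"
  by (rule eqv_trans[OF cov_suc bor_1[OF assms(1)]]) (use assms in simp_all)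

lemma cov_hit:
  assumes "E; G \<turnstile> Eq TSeq u (p \<bullet> n)"
    and "srt E p = Some (Ty (TN \<rightharpoondown> TSeq))" "srt E n = Some (Ty TN)" "srt E u = Some (Ty TSeq)"
  shows "E; G \<turnstile> Eq TB (cov p (suc n) u) b1"
proof -
  have "E; G \<turnstile> Eq TN (enc u) (enc (p \<bullet> n))" by (rule eqv_cong_arg[OF assms(1)]) simp
  then have "E; G \<turnstile> Eq TB (eqn (enc u) (enc u)) (eqn (enc u) (enc (p \<bullet> n)))"
    by (rule eqv_cong_arg) (use assms in simp)
  then have "E; G \<turnstile> Eq TB (eqn (enc u) (enc (p \<bullet> n))) b1"
    by (rule rewrite_left) (rule eqn_refl, use assms in simp)
  then show ?thesis
    by (intro eqv_trans[OF cov_suc bor_2[OF bor_1]]) (use assms in simp_all)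
qed

lemma cov_split:
  assumes "E; G \<turnstile> Eq TB (cov p n (snoc b0 u)) b1" "E; G \<turnstile> Eq TB (cov p n (snoc b1 u)) b1"
    and "srt E p = Some (Ty (TN \<rightharpoondown> TSeq))" "srt E n = Some (Ty TN)" "srt E u = Some (Ty TSeq)"
  shows "E; G \<turnstile> Eq TB (cov p (suc n) u) b1"
  by (rule eqv_trans[OF cov_suc bor_2[OF bor_2[OF eqv_trans[OF band_1[OF assms(1)] assms(2)]]]])
    (use assms in simp_all)

text \<open>The recursion equation is a nested disjunction of bits, inverted from the outside in;
  \<open>eqn_sound\<close> and \<open>enc_inj\<close> turn the test in the middle into an equation
  of nodes.\<close>

lemma cov_E:
  assumes "E; G \<turnstile> Eq TB (cov p (suc n) u) b1"
    and "srt E p = Some (Ty (TN \<rightharpoondown> TSeq))" "srt E n = Some (Ty TN)" "srt E u = Some (Ty TSeq)"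
    and "E; insert (Eq TB (cov p n u) b1) G \<turnstile> C"
    and "E; insert (Eq TSeq u (p \<bullet> n)) G \<turnstile> C"
    and "E; insert (Eq TB (cov p n (snoc b0 u)) b1) (insert (Eq TB (cov p n (snoc b1 u)) b1) G) \<turnstile> C"
  shows "E; G \<turnstile> C"
proof (rule bor_E[OF rewrite_left[OF cov_suc assms(1)] _ _ assms(5)])
  let ?e = "eqn (enc u) (enc (p \<bullet> n))"
  let ?c = "band (cov p n (snoc b0 u)) (cov p n (snoc b1 u))"
  let ?G = "insert (Eq TB (bor ?e ?c) b1) G"
  show "E; ?G \<turnstile> C"
  proof (rule bor_E[OF hyp])
    have "E; insert (Eq TB ?e b1) ?G \<turnstile> Eq TSeq u (p \<bullet> n)"
      by (rule enc_inj[OF eqn_sound[OF hyp]]) (use assms(2-4) in simp_all)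
    then show "E; insert (Eq TB ?e b1) ?G \<turnstile> C"
      by (rule cut) (rule weaken[OF assms(6)], auto)
    show "E; insert (Eq TB ?c b1) ?G \<turnstile> C"
      by (rule band_E[OF hyp _ _ weaken[OF assms(7)]]) (use assms(2-4) in auto)
  qed (use assms(2-4) in simp_all)
qed (use assms(2-4) in simp_all)

text \<open>\<open>add\<close> recurses on its second argument; the rules for the first one serve
  the induction in \<open>cov_add_left\<close>.\<close>

lemma add_zero_left:
  assumes "srt E m = Some (Ty TN)"
  shows "E; G \<turnstile> Eq TN (add zero m) m"
proof -
  have "E; G \<turnstile> All (Ty TN) (Eq TN (add zero (Var 0)) (Var 0))" (is "E; G \<turnstile> All _ ?A")
  proof (rule nat_induct_rule)
    show "E; G \<turnstile> inst zero ?A" by (simp add: inst_def add_zero)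
    have "Ty TN # E; insert ?A (lift ` G) \<turnstile> Eq TN (add zero (suc (Var 0))) (suc (Var 0))"
      by (rule eqv_trans[OF add_suc eqv_cong_arg[OF hyp]]) simp_all
    then show "Ty TN # E; insert ?A (lift ` G) \<turnstile> subst (case_nat (suc (Var 0)) (\<lambda>n. Var (Suc n))) ?A"
      by simp
  qed simp
  then show ?thesis by (rule all_elim) (use assms in \<open>simp_all add: inst_def\<close>)
qed

lemma add_suc_left:
  assumes "srt E n = Some (Ty TN)" "srt E m = Some (Ty TN)"
  shows "E; G \<turnstile> Eq TN (add (suc n) m) (suc (add n m))"
proof -
  let ?n = "tlift n"
  let ?A = "Eq TN (add (suc ?n) (Var 0)) (suc (add ?n (Var 0)))"
  have "E; G \<turnstile> All (Ty TN) ?A"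
  proof (rule nat_induct_rule)
    have "E; G \<turnstile> Eq TN (add (suc n) zero) (suc (add n zero))"
      by (rule eqv_trans[OF add_zero eqv_cong_arg[OF eqv_sym[OF add_zero]]]) (use assms in simp_all)
    then show "E; G \<turnstile> inst zero ?A" by (simp add: inst_def)
    let ?E = "Ty TN # E" and ?G = "insert ?A (lift ` G)"
    have "?E; ?G \<turnstile> Eq TN (add (suc ?n) (suc (Var 0))) (suc (add (suc ?n) (Var 0)))"
      by (rule add_suc) (use assms in simp_all)
    also have "?E; ?G \<turnstile> Eq TN (suc (add (suc ?n) (Var 0))) (suc (suc (add ?n (Var 0))))"
      by (rule eqv_cong_arg[OF hyp]) (use assms in simp_all)
    also have "?E; ?G \<turnstile> Eq TN (suc (suc (add ?n (Var 0)))) (suc (add ?n (suc (Var 0))))"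
      by (rule eqv_cong_arg[OF eqv_sym[OF add_suc]]) (use assms in simp_all)
    finally show "?E; ?G \<turnstile> subst (case_nat (suc (Var 0)) (\<lambda>n. Var (Suc n))) ?A" by simp
  qed (use assms in simp)
  then show ?thesis by (rule all_elim) (use assms in \<open>simp_all add: inst_def\<close>)
qed

lemma cov_cong:
  assumes "E; G \<turnstile> Eq TN n m" "srt E p = Some (Ty (TN \<rightharpoondown> TSeq))" "srt E u = Some (Ty TSeq)"
  shows "E; G \<turnstile> Eq TB (cov p n u) (cov p m u)"
  by (rule eqv_cong_fun[OF eqv_cong_arg[OF assms(1)]]) (use assms in simp_all)

text \<open>Covering persists to later stages, and two stages have their sum as a common later one;
  together with \<open>cov_add_left\<close> this merges the stages of two children.\<close>

lemma cov_add_right: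
  assumes "E; G \<turnstile> Eq TB (cov p n u) b1" "srt E p = Some (Ty (TN \<rightharpoondown> TSeq))"
    and "srt E n = Some (Ty TN)" "srt E m = Some (Ty TN)" "srt E u = Some (Ty TSeq)"
  shows "E; G \<turnstile> Eq TB (cov p (add n m) u) b1"
proof -
  let ?p = "tlift p" and ?n = "tlift n" and ?u = "tlift u"
  let ?A = "Eq TB (cov ?p (add ?n (Var 0)) ?u) b1"
  have "E; G \<turnstile> All (Ty TN) ?A"
  proof (rule nat_induct_rule)
    have "E; G \<turnstile> Eq TB (cov p (add n zero) u) b1"
      by (rule eqv_trans[OF cov_cong[OF add_zero] assms(1)]) (use assms in simp_all)
    then show "E; G \<turnstile> inst zero ?A" by (simp add: inst_def)
    let ?E = "Ty TN # E" and ?G = "insert ?A (lift ` G)"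
    have "?E; ?G \<turnstile> Eq TB (cov ?p (add ?n (suc (Var 0))) ?u) b1"
      by (rule eqv_trans[OF cov_cong[OF add_suc] cov_mono[OF hyp]]) (use assms in simp_all)
    then show "?E; ?G \<turnstile> subst (case_nat (suc (Var 0)) (\<lambda>n. Var (Suc n))) ?A" by simp
  qed (use assms in simp)
  then show ?thesis by (rule all_elim) (use assms in \<open>simp_all add: inst_def\<close>)
qed

lemma cov_add_left:
  assumes "E; G \<turnstile> Eq TB (cov p m u) b1" "srt E p = Some (Ty (TN \<rightharpoondown> TSeq))"
    and "srt E n = Some (Ty TN)" "srt E m = Some (Ty TN)" "srt E u = Some (Ty TSeq)"
  shows "E; G \<turnstile> Eq TB (cov p (add n m) u) b1"
proof -
  let ?p = "tlift p" and ?m = "tlift m" and ?u = "tlift u"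
  let ?A = "Eq TB (cov ?p (add (Var 0) ?m) ?u) b1"
  have "E; G \<turnstile> All (Ty TN) ?A"
  proof (rule nat_induct_rule)
    have "E; G \<turnstile> Eq TB (cov p (add zero m) u) b1"
      by (rule eqv_trans[OF cov_cong[OF add_zero_left] assms(1)]) (use assms in simp_all)
    then show "E; G \<turnstile> inst zero ?A" by (simp add: inst_def)
    let ?E = "Ty TN # E" and ?G = "insert ?A (lift ` G)"
    have "?E; ?G \<turnstile> Eq TB (cov ?p (add (suc (Var 0)) ?m) ?u) b1"
      by (rule eqv_trans[OF cov_cong[OF add_suc_left] cov_mono[OF hyp]]) (use assms in simp_all)
    then show "?E; ?G \<turnstile> subst (case_nat (suc (Var 0)) (\<lambda>n. Var (Suc n))) ?A" by simp
  qed (use assms in simp)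
  then show ?thesis by (rule all_elim) (use assms in \<open>simp_all add: inst_def\<close>)
qed

section \<open>Initial segments and enumerated sequences\<close>

lemma init_seg_zero:
  assumes "srt E a = Some (Ty cantor)"
  shows "E; G \<turnstile> Eq TSeq (init_seg a zero) nil"
  unfolding init_seg_def by (rule recN_zero) (use assms in simp_all)

lemma init_seg_suc:
  assumes "srt E a = Some (Ty cantor)" "srt E n = Some (Ty TN)"
  shows "E; G \<turnstile> Eq TSeq (init_seg a (suc n)) (snoc (a \<bullet> n) (init_seg a n))"
  unfolding init_seg_def
  by (rule eqv_trans[OF recN_suc eqv_cong_fun[OF eqv_trans[OF comb_S eqv_cong_fun[OF comb_K]]]])
    (use assms in simp_all)

lemma enum_byI:
  assumes "E; G \<turnstile> Eq TSeq (init_seg a n) (p \<bullet> k)" "srt E p = Some (Ty (TN \<rightharpoondown> TSeq))"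
    and "srt E a = Some (Ty cantor)" "srt E n = Some (Ty TN)" "srt E k = Some (Ty TN)"
  shows "E; G \<turnstile> enum_by p a"
  unfolding enum_by_def
  by (rule ex_intro[of _ _ n], simp add: inst_def, rule ex_intro[of _ _ k]) (use assms in \<open>simp_all add: inst_def\<close>)

lemma enum_byE:
  assumes "E; G \<turnstile> enum_by p a" "wf_fm E C"
    and "Ty TN # Ty TN # E; insert (Eq TSeq (init_seg (tlift (tlift a)) (Var 1)) (tlift (tlift p) \<bullet> Var 0))
      (lift ` lift ` G) \<turnstile> lift (lift C)"
  shows "E; G \<turnstile> C"
proof (rule derivable.ExE[OF assms(1)[unfolded enum_by_def] assms(2)], rule derivable.ExE[OF hyp])
  let ?A = "Eq TSeq (init_seg (tlift (tlift a)) (Var 1)) (tlift (tlift p) \<bullet> Var 0)"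
  have wf: "wf_fm (Ty TN # Ty TN # E) ?A"
    using entails_wf[OF assms(1)] by (simp add: enum_by_def)
  then show "wf_fm (Ty TN # E) (Ex (Ty TN) ?A)" by simp
  show "wf_fm (Ty TN # E) (lift C)" using assms(2) by (rule wf_lift)
  show "Ty TN # Ty TN # E; insert ?A (lift ` insert (Ex (Ty TN) ?A) (lift ` G)) \<turnstile> lift (lift C)"
    by (rule weaken[OF assms(3)]) auto
qed

section \<open>Barred nodes\<close>

lemma barredI:
  assumes "E; G \<turnstile> Eq TB (cov p n u) b1"
    and "srt E p = Some (Ty (TN \<rightharpoondown> TSeq))" "srt E n = Some (Ty TN)" "srt E u = Some (Ty TSeq)"
  shows "E; G \<turnstile> barred p u"
proof -
  have "E; G \<turnstile> Eq TN (cond TN (suc zero) zero (cov p n u)) zero"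
    by (rule eqv_trans[OF eqv_cong_arg[OF assms(1)] cond_1]) simp_all
  then show ?thesis
    unfolding barred_def by (intro ex_intro[of _ _ n]) (use assms in \<open>simp_all add: inst_def\<close>)
qed

lemma barredE:
  assumes "E; G \<turnstile> barred p u" "srt E p = Some (Ty (TN \<rightharpoondown> TSeq))" "srt E u = Some (Ty TSeq)" "wf_fm E C"
    and "Ty TN # E; insert (Eq TB (cov (tlift p) (Var 0) (tlift u)) b1) (lift ` G) \<turnstile> lift C"
  shows "E; G \<turnstile> C"
proof (rule derivable.ExE[OF assms(1)[unfolded barred_def] assms(4)])
  let ?c = "cov (tlift p) (Var 0) (tlift u)"
  let ?A = "Eq TN (cond TN (suc zero) zero ?c) zero"
  show "Ty TN # E; insert ?A (lift ` G) \<turnstile> lift C"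
  \<comment> \<open>At bit 0 the conditional has value 1, contradicting the equation
    \<open>?A\<close>, so bit 1 remains.\<close>
  proof (rule bool_cases[of _ ?c])
    let ?G = "insert (Eq TB ?c b0) (insert ?A (lift ` G))"
    have "Ty TN # E; ?G \<turnstile> Eq TN (cond TN (suc zero) zero ?c) (suc zero)"
      by (rule eqv_trans[OF eqv_cong_arg[OF hyp] cond_0]) (use assms(2,3) in simp_all)
    moreover have "Ty TN # E; ?G \<turnstile> ?A"
      by (rule derivable.Hyp) (use assms(2,3) in simp_all)
    ultimately have "Ty TN # E; ?G \<turnstile> Eq TN zero (suc zero)"
      by (rule rewrite_left[OF eqv_sym[OF eqv_sym], rotated])
    then have "Ty TN # E; ?G \<turnstile> Bot"
      by (rule derivable.ImpE[OF derivable.Arith[OF ha_axiom.zero_not_suc], rotated]) simp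
    then show "Ty TN # E; ?G \<turnstile> lift C" by (rule derivable.BotE) (rule wf_lift[OF assms(4)])
    show "Ty TN # E; insert (Eq TB ?c b1) (insert ?A (lift ` G)) \<turnstile> lift C"
      by (rule weaken[OF assms(5)]) auto
  qed (use assms(2,3) in simp)
qed

lemma barred_cong:
  assumes "E; G \<turnstile> Eq TSeq u v" "E; G \<turnstile> barred p u" "srt E p = Some (Ty (TN \<rightharpoondown> TSeq))"
  shows "E; G \<turnstile> barred p v"
  using replace[OF assms(1), of "barred (tlift p) (Var 0)"] assms by (simp add: inst_def)

lemma barred_split:
  assumes "E; G \<turnstile> barred p (snoc b0 u)" "E; G \<turnstile> barred p (snoc b1 u)"
    and "srt E p = Some (Ty (TN \<rightharpoondown> TSeq))" "srt E u = Some (Ty TSeq)"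
  shows "E; G \<turnstile> barred p u"
\<comment> \<open>The right child is put into the context first, so that it is lifted along when the
  stage of the left child is opened.\<close>
proof (rule cut[OF assms(2)], rule barredE[OF weaken_insert[OF assms(1)]])
  let ?p = "tlift p" and ?u = "tlift u"
  let ?p2 = "tlift ?p" and ?u2 = "tlift ?u"
  let ?E = "Ty TN # E" and ?A = "Eq TB (cov ?p (Var 0) (snoc b0 ?u)) b1"
  let ?G = "insert ?A (lift ` insert (barred p (snoc b1 u)) G)"
  let ?B = "Eq TB (cov ?p2 (Var 0) (snoc b1 ?u2)) b1"
  let ?H = "insert ?B (lift ` ?G)"
  \<comment> \<open>The stages are \<open>Var 1\<close> for the left child and \<open>Var 0\<close>
    for the right one; at their sum both are covered, and one stage later the parent is.\<close>
  have H: "Ty TN # ?E; ?H \<turnstile> barred ?p2 ?u2"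
  proof (rule barredI, rule cov_split)
    show "Ty TN # ?E; ?H \<turnstile> Eq TB (cov ?p2 (add (Var 0) (Var 1)) (snoc b0 ?u2)) b1"
      by (rule cov_add_left, rule derivable.Hyp) (use assms in simp_all)
    show "Ty TN # ?E; ?H \<turnstile> Eq TB (cov ?p2 (add (Var 0) (Var 1)) (snoc b1 ?u2)) b1"
      by (rule cov_add_right, rule derivable.Hyp) (use assms in simp_all)
  qed (use assms in simp_all)
  have "?E; ?G \<turnstile> barred ?p (snoc b1 ?u)" by (rule derivable.Hyp) (use assms in simp_all)
  then have "?E; ?G \<turnstile> barred ?p ?u" by (rule barredE) (use assms H in simp_all)
  then show "?E; insert (Eq TB (cov ?p (Var 0) (tlift (snoc b0 u))) b1)
      (lift ` insert (barred p (snoc b1 u)) G) \<turnstile> lift (barred p u)"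
    by simp
qed (use assms in simp_all)

lemma init_seg_suc_bit:
  assumes "E; G \<turnstile> Eq TB (a \<bullet> n) b" "srt E a = Some (Ty cantor)" "srt E n = Some (Ty TN)"
  shows "E; G \<turnstile> Eq TSeq (init_seg a (suc n)) (snoc b (init_seg a n))"
  by (rule eqv_trans[OF init_seg_suc eqv_cong_fun[OF eqv_cong_arg[OF assms(1)]]])
    (use assms in simp_all)

text \<open>If both children of an initial segment are covered, the next bit of \<open>a\<close>
  selects the one through which \<open>a\<close> passes, and that child is the next initial segment.
  Hence induction on the stage works.\<close>

lemma cov_sound:
  assumes "E; G \<turnstile> Eq TB (cov p n (init_seg a m)) b1" "srt E p = Some (Ty (TN \<rightharpoondown> TSeq))"
    and "srt E n = Some (Ty TN)" "srt E a = Some (Ty cantor)" "srt E m = Some (Ty TN)"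
  shows "E; G \<turnstile> enum_by p a"
proof -
  let ?p = "tlift (tlift p)" and ?a = "tlift (tlift a)"
  let ?F = "\<lambda>n m. Imp (Eq TB (cov ?p n (init_seg ?a m)) b1) (enum_by ?p ?a)"
  \<comment> \<open>The length is quantified inside the induction on the stage, because the
    splitting case applies the hypothesis to a segment longer by one.\<close>
  let ?A = "All (Ty TN) (?F (Var 1) (Var 0))"
  have "E; G \<turnstile> All (Ty TN) ?A"
  proof (rule nat_induct_rule)
    let ?H = "Eq TB (cov (tlift p) zero (init_seg (tlift a) (Var 0))) b1"
    have "Ty TN # E; insert ?H (lift ` G) \<turnstile> enum_by (tlift p) (tlift a)"
      by (rule b0_neq_b1[OF cov_zero hyp]) (use assms in simp_all)
    then show "E; G \<turnstile> inst zero ?A"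
      using assms by (auto simp: inst_def intro!: derivable.AllI derivable.ImpI)
  next
    let ?E = "Ty TN # Ty TN # E" and ?n = "Var 1" and ?m = "Var 0"
    let ?H = "insert (Eq TB (cov ?p (suc ?n) (init_seg ?a ?m)) b1) (lift ` insert ?A (lift ` G))"
    \<comment> \<open>The induction hypothesis at an arbitrary length and under any larger set of
      assumptions.\<close>
    have ih: "?E; H \<turnstile> enum_by ?p ?a"
      if "?E; H \<turnstile> Eq TB (cov ?p ?n (init_seg ?a k)) b1" "?H \<subseteq> H" "srt ?E k = Some (Ty TN)" for H k
    proof -
      have "?E; H \<turnstile> lift ?A" by (rule derivable.Hyp) (use that(2) assms in auto)
      then have "?E; H \<turnstile> ?F ?n k"
        unfolding subst.simps by (rule all_elim) (use that in \<open>simp_all add: inst_def\<close>)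
      then show ?thesis using that(1) by (rule derivable.ImpE)
    qed
    have "?E; ?H \<turnstile> enum_by ?p ?a"
    proof (rule cov_E[OF hyp])
      show "?E; insert (Eq TB (cov ?p ?n (init_seg ?a ?m)) b1) ?H \<turnstile> enum_by ?p ?a"
        by (rule ih[OF hyp]) (use assms in auto)
      show "?E; insert (Eq TSeq (init_seg ?a ?m) (?p \<bullet> ?n)) ?H \<turnstile> enum_by ?p ?a"
        by (rule enum_byI[OF hyp]) (use assms in simp_all)
      let ?C0 = "Eq TB (cov ?p ?n (snoc b0 (init_seg ?a ?m))) b1"
      let ?C1 = "Eq TB (cov ?p ?n (snoc b1 (init_seg ?a ?m))) b1"
      let ?K = "insert ?C0 (insert ?C1 ?H)"
      have child: "?E; insert (Eq TB (?a \<bullet> ?m) b) ?K \<turnstile> enum_by ?p ?a"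
        if "srt ?E b = Some (Ty TB)" "Eq TB (cov ?p ?n (snoc b (init_seg ?a ?m))) b1 \<in> ?K" for b
      proof (rule ih)
        let ?K' = "insert (Eq TB (?a \<bullet> ?m) b) ?K"
        have "?E; ?K' \<turnstile> Eq TB (cov ?p ?n (init_seg ?a (suc ?m))) (cov ?p ?n (snoc b (init_seg ?a ?m)))"
          by (rule eqv_cong_arg[OF init_seg_suc_bit[OF hyp]]) (use assms that in simp_all)
        also have "?E; ?K' \<turnstile> Eq TB (cov ?p ?n (snoc b (init_seg ?a ?m))) b1"
          by (rule weaken_insert, rule derivable.Hyp) (use assms that in simp_all)
        finally show "?E; ?K' \<turnstile> Eq TB (cov ?p ?n (init_seg ?a (suc ?m))) b1" .
      qed (use assms in auto)
      show "?E; ?K \<turnstile> enum_by ?p ?a"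
        by (rule bool_cases[OF _ child child]) (use assms in simp_all)
    qed (use assms in simp_all)
    then have "Ty TN # E; insert ?A (lift ` G) \<turnstile> All (Ty TN) (?F (suc ?n) ?m)"
      by (intro derivable.AllI derivable.ImpI) (use assms in simp_all)
    then show "Ty TN # E; insert ?A (lift ` G) \<turnstile>
        subst (case_nat (suc (Var 0)) (\<lambda>n. Var (Suc n))) ?A"
      by simp
  qed (use assms in simp)
  then have "E; G \<turnstile> All (Ty TN) (Imp (Eq TB (cov (tlift p) (tlift n) (init_seg (tlift a) (Var 0))) b1)
      (enum_by (tlift p) (tlift a)))"
    by (rule all_elim) (use assms in \<open>simp_all add: inst_def\<close>)
  then have "E; G \<turnstile> Imp (Eq TB (cov p n (init_seg a m)) b1) (enum_by p a)"
    by (rule all_elim) (use assms in \<open>simp_all add: inst_def\<close>)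
  then show ?thesis using assms(1) by (rule derivable.ImpE)
qed

lemma barred_sound:
  assumes "E; G \<turnstile> barred p (init_seg a m)"
    and "srt E p = Some (Ty (TN \<rightharpoondown> TSeq))" "srt E a = Some (Ty cantor)" "srt E m = Some (Ty TN)"
  shows "E; G \<turnstile> enum_by p a"
proof (rule barredE[OF assms(1)])
  let ?H = "Eq TB (cov (tlift p) (Var 0) (init_seg (tlift a) (tlift m))) b1"
  have "Ty TN # E; insert ?H (lift ` G) \<turnstile> enum_by (tlift p) (tlift a)"
    by (rule cov_sound[OF hyp]) (use assms in simp_all)
  then show "Ty TN # E; insert (Eq TB (cov (tlift p) (Var 0) (tlift (init_seg a m))) b1) (lift ` G) \<turnstile>
      lift (enum_by p a)"
    by simp
qed (use assms in simp_all)

section \<open>The branch of a decidable set\<close>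

lemma branch_eq_path:
  assumes "srt E f = Some (Ty cantor)" "srt E n = Some (Ty TN)"
  shows "E; G \<turnstile> Eq TB (branch \<bullet> f \<bullet> n) (f \<bullet> enc (snoc b0 (path_seq f n)))"
  using beta2[of TN cantor "Var 1 \<bullet> enc (snoc b0 (path_seq (Var 1) (Var 0)))" TB E f n G] assms
  by (simp add: branch_def)

lemma path_seq_suc:
  assumes "srt E f = Some (Ty cantor)" "srt E n = Some (Ty TN)"
  shows "E; G \<turnstile> Eq TSeq (path_seq f (suc n)) (snoc (f \<bullet> enc (snoc b0 (path_seq f n))) (path_seq f n))"
proof -
  have step: "E; G \<turnstile> Eq TSeq (path_step \<bullet> f \<bullet> n \<bullet> u) (snoc (f \<bullet> enc (snoc b0 u)) u)"
    if "srt E u = Some (Ty TSeq)" for u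
    using beta3[of TSeq TN cantor "snoc (Var 2 \<bullet> enc (snoc b0 (Var 0))) (Var 0)" TSeq E f n u G]
      that assms by (simp add: path_step_def)
  show ?thesis by (rule eqv_trans[OF recN_suc step]) (use assms in simp_all)
qed

text \<open>Both sides extend by the same bit. This removes the auxiliary path: afterwards
  \<open>branch_eq\<close> determines each bit from the initial segment of the branch
  itself.\<close>

lemma init_seg_branch:
  assumes "srt E f = Some (Ty cantor)" "srt E n = Some (Ty TN)"
  shows "E; G \<turnstile> Eq TSeq (init_seg (branch \<bullet> f) n) (path_seq f n)"
proof -
  let ?f = "tlift f"
  let ?A = "Eq TSeq (init_seg (branch \<bullet> ?f) (Var 0)) (path_seq ?f (Var 0))"
  have "E; G \<turnstile> All (Ty TN) ?A"
  proof (rule nat_induct_rule)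
    have "E; G \<turnstile> Eq TSeq (init_seg (branch \<bullet> f) zero) (path_seq f zero)"
      by (rule eqv_trans[OF init_seg_zero eqv_sym[OF recN_zero]]) (use assms in simp_all)
    then show "E; G \<turnstile> inst zero ?A" by (simp add: inst_def)
    let ?E = "Ty TN # E" and ?G = "insert ?A (lift ` G)" and ?n = "Var 0"
    have "?E; ?G \<turnstile> Eq TSeq (init_seg (branch \<bullet> ?f) (suc ?n))
        (snoc (?f \<bullet> enc (snoc b0 (path_seq ?f ?n))) (init_seg (branch \<bullet> ?f) ?n))"
      by (rule init_seg_suc_bit[OF branch_eq_path]) (use assms in simp_all)
    also have "?E; ?G \<turnstile> Eq TSeq (snoc (?f \<bullet> enc (snoc b0 (path_seq ?f ?n))) (init_seg (branch \<bullet> ?f) ?n))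
        (snoc (?f \<bullet> enc (snoc b0 (path_seq ?f ?n))) (path_seq ?f ?n))"
      by (rule eqv_cong_arg[OF hyp]) (use assms in simp_all)
    also have "?E; ?G \<turnstile> Eq TSeq (snoc (?f \<bullet> enc (snoc b0 (path_seq ?f ?n))) (path_seq ?f ?n))
        (path_seq ?f (suc ?n))"
      by (rule eqv_sym, rule path_seq_suc) (use assms in simp_all)
    finally show "?E; ?G \<turnstile> subst (case_nat (suc (Var 0)) (\<lambda>n. Var (Suc n))) ?A" by simp
  qed (use assms in simp)
  then show ?thesis by (rule all_elim) (use assms in \<open>simp_all add: inst_def\<close>)
qed

lemma branch_eq:
  assumes "srt E f = Some (Ty cantor)" "srt E n = Some (Ty TN)"
  shows "E; G \<turnstile> Eq TB (branch \<bullet> f \<bullet> n) (f \<bullet> enc (snoc b0 (init_seg (branch \<bullet> f) n)))"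
  by (rule eqv_trans[OF branch_eq_path eqv_cong_arg[OF eqv_cong_arg[OF eqv_cong_arg[OF eqv_sym[OF init_seg_branch]]]]])
    (use assms in simp_all)

lemma char_of_cases:
  assumes "E; G \<turnstile> char_of f C" "srt E x = Some (Ty TN)"
  shows "E; G \<turnstile> Or (And (Eq TB (f \<bullet> x) b1) (Mem x C)) (And (Eq TB (f \<bullet> x) b0) (Not (Mem x C)))"
  by (rule all_elim[OF assms(1)[unfolded char_of_def]]) (use assms in \<open>simp_all add: inst_def\<close>)

lemma char_of_Mem:
  assumes "E; G \<turnstile> char_of f C" "E; G \<turnstile> Eq TB (f \<bullet> x) b1"
    and "srt E f = Some (Ty cantor)" "srt E C = Some PowN" "srt E x = Some (Ty TN)"
  shows "E; G \<turnstile> Mem x C"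
proof (rule derivable.OrE[OF char_of_cases[OF assms(1,5)]])
  show "E; insert (And (Eq TB (f \<bullet> x) b1) (Mem x C)) G \<turnstile> Mem x C"
    by (rule derivable.AndE2[OF hyp]) (use assms in simp)
  show "E; insert (And (Eq TB (f \<bullet> x) b0) (Not (Mem x C))) G \<turnstile> Mem x C"
    by (rule b0_neq_b1[OF derivable.AndE1[OF hyp] weaken_insert[OF assms(2)]]) (use assms in simp_all)
qed

lemma char_of_not_Mem:
  assumes "E; G \<turnstile> char_of f C" "E; G \<turnstile> Eq TB (f \<bullet> x) b0"
    and "srt E f = Some (Ty cantor)" "srt E C = Some PowN" "srt E x = Some (Ty TN)"
  shows "E; G \<turnstile> Not (Mem x C)"
proof (rule derivable.OrE[OF char_of_cases[OF assms(1,5)]])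
  show "E; insert (And (Eq TB (f \<bullet> x) b1) (Mem x C)) G \<turnstile> Not (Mem x C)"
    by (rule b0_neq_b1[OF weaken_insert[OF assms(2)] derivable.AndE1[OF hyp]]) (use assms in simp_all)
  show "E; insert (And (Eq TB (f \<bullet> x) b0) (Not (Mem x C))) G \<turnstile> Not (Mem x C)"
    by (rule derivable.AndE2[OF hyp]) (use assms in simp)
qed

text \<open>A right turn at a node means that the code of its left child is in \<open>C\<close>,
  hence in \<open>good\<close>; decoding the code returns the child.\<close>

lemma barred_branch:
  assumes "hyps f C p \<subseteq> G" "E; G \<turnstile> Eq TB (branch \<bullet> f \<bullet> k) b1"
    and "srt E f = Some (Ty cantor)" "srt E C = Some PowN" "srt E p = Some (Ty (TN \<rightharpoondown> TSeq))"
    and "srt E k = Some (Ty TN)"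
  shows "E; G \<turnstile> Or (barred p (snoc b0 (init_seg (branch \<bullet> f) k))) (barred p nil)"
proof -
  let ?u = "snoc b0 (init_seg (branch \<bullet> f) k)"
  have "E; G \<turnstile> Eq TB (f \<bullet> enc ?u) b1"
    by (rule rewrite_left[OF branch_eq assms(2)]) (use assms in simp_all)
  then have mem: "E; G \<turnstile> Mem (enc ?u) C"
    by (intro char_of_Mem[OF derivable.Hyp]) (use assms in \<open>auto simp: hyps_def\<close>)
  have "E; G \<turnstile> good_subset C p" by (rule derivable.Hyp) (use assms in \<open>auto simp: hyps_def\<close>)
  then have "E; G \<turnstile> Imp (Mem (enc ?u) C) (good p (enc ?u))"
    unfolding good_subset_def by (rule all_elim) (use assms in \<open>simp_all add: inst_def\<close>)
  from derivable.ImpE[OF this mem] have "E; G \<turnstile> Or (barred p (dec (enc ?u))) (barred p nil)"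
    unfolding good_def .
  then show ?thesis
  proof (rule derivable.OrE)
    show "E; insert (barred p (dec (enc ?u))) G \<turnstile> Or (barred p ?u) (barred p nil)"
      by (rule derivable.OrI1[OF barred_cong[OF dec_enc hyp]]) (use assms in simp_all)
    show "E; insert (barred p nil) G \<turnstile> Or (barred p ?u) (barred p nil)"
      by (rule derivable.OrI2[OF _ hyp]) (use assms in simp_all)
  qed
qed

text \<open>A sequence below the branch leaves it to the left where the branch turns right. By
  \<open>barred_branch\<close> the left child there, or else the root, is barred, and the sequence
  passes through it; progressivity then takes in the branch.\<close>

lemma enum_by_branch:
  assumes "srt E f = Some (Ty cantor)" "srt E C = Some PowN" "srt E p = Some (Ty (TN \<rightharpoondown> TSeq))"
  shows "E; hyps f C p \<turnstile> enum_by p (branch \<bullet> f)"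
proof -
  let ?f1 = "tlift f" and ?C1 = "tlift C" and ?p1 = "tlift p"
  let ?f = "tlift (tlift f)" and ?C = "tlift (tlift C)" and ?p = "tlift (tlift p)"
  let ?a = "branch \<bullet> ?f" and ?b = "Var 1" and ?k = "Var 0"
  let ?E1 = "Ty cantor # E" and ?G1 = "insert (lex_less (Var 0) (branch \<bullet> ?f1)) (hyps ?f1 ?C1 ?p1)"
  let ?E = "Ty TN # ?E1"
  let ?L = "And (Eq TSeq (init_seg ?b ?k) (init_seg ?a ?k))
      (And (Eq TB (?b \<bullet> ?k) b0) (Eq TB (?a \<bullet> ?k) b1))"
  let ?G = "insert ?L (lift ` ?G1)"
  have L: "?E; ?G \<turnstile> ?L" by (rule hyp) (use assms in simp)
  note eqs = derivable.AndE1[OF L] derivable.AndE1[OF derivable.AndE2[OF L]]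
    derivable.AndE2[OF derivable.AndE2[OF L]]
  \<comment> \<open>Both sequences agree up to \<open>?k\<close>, so the left child of the branch is
    the segment of the smaller sequence of length \<open>suc ?k\<close>.\<close>
  have suc_k: "?E; ?G \<turnstile> Eq TSeq (snoc b0 (init_seg ?a ?k)) (init_seg ?b (suc ?k))"
    by (rule eqv_sym, rule eqv_trans[OF init_seg_suc_bit[OF eqs(2)] eqv_cong_arg[OF eqs(1)]]) simp_all
  have "?E; ?G \<turnstile> enum_by ?p ?b"
  proof (rule derivable.OrE[OF barred_branch[OF _ eqs(3)]])
    show "hyps ?f ?C ?p \<subseteq> ?G" by (simp add: image_insert) auto
    show "?E; insert (barred ?p (snoc b0 (init_seg ?a ?k))) ?G \<turnstile> enum_by ?p ?b"
      by (rule barred_sound[OF barred_cong[OF weaken_insert[OF suc_k] hyp]]) (use assms in simp_all)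
    \<comment> \<open>The root is the segment of length zero of any sequence.\<close>
    show "?E; insert (barred ?p nil) ?G \<turnstile> enum_by ?p ?b"
      by (rule barred_sound[OF barred_cong[OF eqv_sym[OF init_seg_zero] hyp]]) (use assms in simp_all)
  qed (use assms in simp_all)
  then have body: "?E; ?G \<turnstile> lift (enum_by ?p1 (Var 0))" by simp
  have "?E1; ?G1 \<turnstile> lex_less (Var 0) (branch \<bullet> ?f1)" by (rule hyp) (use assms in simp)
  then have "?E1; ?G1 \<turnstile> Ex (Ty TN) ?L" by (simp add: lex_less_def)
  then have "?E1; ?G1 \<turnstile> enum_by ?p1 (Var 0)"
    by (rule derivable.ExE[OF _ _ body]) (use assms in simp)
  then have "E; hyps f C p \<turnstile> All (Ty cantor) (Imp (lex_less (Var 0) (branch \<bullet> ?f1)) (enum_by ?p1 (Var 0)))"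
    by (intro derivable.AllI derivable.ImpI) (use assms in simp_all)
  moreover have "E; hyps f C p \<turnstile> progressive p"
    by (rule derivable.Hyp) (use assms in \<open>auto simp: hyps_def\<close>)
  then have "E; hyps f C p \<turnstile> Imp (All (Ty cantor) (Imp (lex_less (Var 0) (branch \<bullet> ?f1)) (enum_by ?p1 (Var 0))))
      (enum_by p (branch \<bullet> f))"
    unfolding progressive_def by (rule all_elim[where t = "branch \<bullet> f"]) (use assms in \<open>simp_all add: inst_def\<close>)
  ultimately show ?thesis by (blast intro: derivable.ImpE)
qed

lemma good_outsideI:
  assumes "E; G \<turnstile> Not (Mem x C)" "E; G \<turnstile> good p x"
    and "srt E C = Some PowN" "srt E p = Some (Ty (TN \<rightharpoondown> TSeq))" "srt E x = Some (Ty TN)"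
  shows "E; G \<turnstile> good_outside C p"
  unfolding good_outside_def
  by (rule ex_intro[of _ _ x], simp add: inst_def, rule derivable.AndI) (use assms in simp_all)

text \<open>Once the root is barred every number is good, in particular the one that
  \<open>proper\<close> provides outside \<open>C\<close>.\<close>

lemma good_outside_nil:
  assumes "proper C \<in> G" "E; G \<turnstile> barred p nil"
    and "srt E C = Some PowN" "srt E p = Some (Ty (TN \<rightharpoondown> TSeq))"
  shows "E; G \<turnstile> good_outside C p"
proof (rule cut[OF assms(2)])
  let ?G = "insert (barred p nil) G" and ?A = "Not (Mem (Var 0) (tlift C))"
  have "E; ?G \<turnstile> proper C" by (rule derivable.Hyp) (use assms in simp_all)
  then show "E; ?G \<turnstile> good_outside C p"
    unfolding proper_def
  proof (rule derivable.ExE)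
    have "Ty TN # E; insert ?A (lift ` ?G) \<turnstile> good_outside (tlift C) (tlift p)"
    proof (rule good_outsideI)
      show "Ty TN # E; insert ?A (lift ` ?G) \<turnstile> Not (Mem (Var 0) (tlift C))"
        by (rule hyp) (use assms in simp)
      show "Ty TN # E; insert ?A (lift ` ?G) \<turnstile> good (tlift p) (Var 0)"
        unfolding good_def
        by (rule derivable.OrI2, simp add: assms, rule derivable.Hyp) (use assms in simp_all)
    qed (use assms in simp_all)
    then show "Ty TN # E; insert ?A (lift ` ?G) \<turnstile> lift (good_outside C p)" by simp
  qed (use assms in simp)
qed

text \<open>Back along the branch, by induction on the length of a barred segment: a left turn
  exhibits the wanted number, a right turn leads to a shorter barred segment or to a barred root,
  and length zero is the root.\<close>

lemma good_outside_branch: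
  assumes "srt E f = Some (Ty cantor)" "srt E C = Some PowN" "srt E p = Some (Ty (TN \<rightharpoondown> TSeq))"
    and "srt E n = Some (Ty TN)"
  shows "E; hyps f C p \<turnstile> Imp (barred p (init_seg (branch \<bullet> f) n)) (good_outside C p)"
proof -
  let ?f = "tlift f" and ?C = "tlift C" and ?p = "tlift p"
  let ?F = "\<lambda>n. Imp (barred ?p (init_seg (branch \<bullet> ?f) n)) (good_outside ?C ?p)"
  let ?A = "?F (Var 0)"
  have "E; hyps f C p \<turnstile> All (Ty TN) ?A"
  proof (rule nat_induct_rule)
    let ?B = "barred p (init_seg (branch \<bullet> f) zero)"
    have "E; insert ?B (hyps f C p) \<turnstile> good_outside C p"
      by (rule good_outside_nil[OF _ barred_cong[OF init_seg_zero hyp]])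
        (use assms in \<open>simp_all add: hyps_def\<close>)
    then have "E; hyps f C p \<turnstile> Imp ?B (good_outside C p)"
      by (intro derivable.ImpI) (use assms in simp)
    then show "E; hyps f C p \<turnstile> inst zero ?A" by (simp add: inst_def)
  next
    let ?E = "Ty TN # E" and ?n = "Var 0" and ?a = "branch \<bullet> ?f"
    let ?G = "insert (barred ?p (init_seg ?a (suc ?n))) (insert ?A (hyps ?f ?C ?p))"
    let ?u = "init_seg ?a ?n"
    have child: "?E; insert (Eq TB (?a \<bullet> ?n) b) ?G \<turnstile> barred ?p (snoc b ?u)"
      if "srt ?E b = Some (Ty TB)" for b
      by (rule barred_cong[OF init_seg_suc_bit[OF hyp] weaken_insert[OF hyp]]) (use assms that in simp_all)
    have "?E; ?G \<turnstile> good_outside ?C ?p"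
    proof (rule bool_cases[of _ "?a \<bullet> ?n"])
      \<comment> \<open>Left turn: the longer segment, which is barred, is the left child, and its
        code lies outside \<open>C\<close> by the choice of the branch.\<close>
      let ?H = "insert (Eq TB (?a \<bullet> ?n) b0) ?G"
      show "?E; ?H \<turnstile> good_outside ?C ?p"
      proof (rule good_outsideI[of _ _ "enc (snoc b0 ?u)"])
        have "?E; ?H \<turnstile> Eq TB (?f \<bullet> enc (snoc b0 ?u)) b0"
          by (rule rewrite_left[OF branch_eq hyp]) (use assms in simp_all)
        then show "?E; ?H \<turnstile> Not (Mem (enc (snoc b0 ?u)) ?C)"
          by (rule char_of_not_Mem[OF derivable.Hyp, rotated 2]) (use assms in \<open>simp_all add: hyps_def\<close>)
        show "?E; ?H \<turnstile> good ?p (enc (snoc b0 ?u))"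
          unfolding good_def
          by (rule derivable.OrI1[OF barred_cong[OF eqv_sym[OF dec_enc] child]]) (use assms in simp_all)
      qed (use assms in simp_all)
    next
      let ?H = "insert (Eq TB (?a \<bullet> ?n) b1) ?G"
      show "?E; ?H \<turnstile> good_outside ?C ?p"
      proof (rule derivable.OrE[OF barred_branch[OF _ hyp]])
        show "hyps ?f ?C ?p \<subseteq> ?H" by auto
        \<comment> \<open>Right turn: the longer segment is the right child and
          \<open>barred_branch\<close> supplies the left one, so the node itself is barred and the
          hypothesis applies.\<close>
        let ?K = "insert (barred ?p (snoc b0 ?u)) ?H"
        have "?E; ?K \<turnstile> barred ?p ?u"
          by (rule barred_split[OF hyp weaken_insert[OF child]]) (use assms in simp_all)
        moreover have "?E; ?K \<turnstile> ?A" by (rule derivable.Hyp) (use assms in simp_all)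
        ultimately show "?E; ?K \<turnstile> good_outside ?C ?p" by (blast intro: derivable.ImpE)
        show "?E; insert (barred ?p nil) ?H \<turnstile> good_outside ?C ?p"
          by (rule good_outside_nil[OF _ hyp]) (use assms in \<open>simp_all add: hyps_def\<close>)
      qed (use assms in simp_all)
    qed (use assms in simp)
    then have "?E; insert ?A (hyps ?f ?C ?p) \<turnstile> ?F (suc ?n)"
      by (rule derivable.ImpI[rotated]) (use assms in simp)
    then show "?E; insert ?A (lift ` hyps f C p) \<turnstile> subst (case_nat (suc (Var 0)) (\<lambda>n. Var (Suc n))) ?A"
      by simp
  qed (use assms in simp)
  then show ?thesis by (rule all_elim) (use assms in \<open>simp_all add: inst_def\<close>)
qed

lemma good_outside:
  assumes "srt E f = Some (Ty cantor)" "srt E C = Some PowN" "srt E p = Some (Ty (TN \<rightharpoondown> TSeq))"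
  shows "E; hyps f C p \<turnstile> good_outside C p"
proof (rule enum_byE[OF enum_by_branch[OF assms]])
  let ?f = "tlift (tlift f)" and ?C = "tlift (tlift C)" and ?p = "tlift (tlift p)"
  let ?E = "Ty TN # Ty TN # E" and ?a = "branch \<bullet> ?f"
  let ?G = "insert (Eq TSeq (init_seg ?a (Var 1)) (?p \<bullet> Var 0)) (hyps ?f ?C ?p)"
  \<comment> \<open>\<open>Var 1\<close> is the length of the segment and \<open>Var 0\<close> the
    index of the value it equals; a value is covered at the stage after its index.\<close>
  have "?E; ?G \<turnstile> barred ?p (init_seg ?a (Var 1))"
    by (rule barredI[OF cov_hit[OF hyp]]) (use assms in simp_all)
  then have "?E; ?G \<turnstile> good_outside ?C ?p"
    by (rule derivable.ImpE[OF weaken_insert[OF good_outside_branch], rotated -1]) (use assms in simp_all)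
  then show "?E; insert (Eq TSeq (init_seg (tlift (tlift (branch \<bullet> f))) (Var 1)) (?p \<bullet> Var 0))
      (lift ` lift ` hyps f C p) \<turnstile> lift (lift (good_outside C p))"
    by simp
qed (use assms in simp)

section \<open>Applying unique choice and EnDec\<close>

text \<open>Decidability yields for each number exactly one bit that agrees with membership, and
  unique choice collects the bits. The set \<open>C\<close> is a parameter of the instance of
  choice.\<close>

lemma char_of_exists:
  assumes "AC_unique_0B \<subseteq> T" "E; G \<turnstile> decidable_set C" "srt E C = Some PowN"
  shows "E; G \<turnstile> Ex (Ty cantor) (char_of (Var 0) (tlift C))"
proof -
  let ?C = "tlift C" and ?C2 = "tlift (tlift C)" and ?C3 = "tlift (tlift (tlift C))"
  let ?F = "\<lambda>y x C. Or (And (Eq TB y b1) (Mem x C)) (And (Eq TB y b0) (Not (Mem x C)))"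
  let ?A = "?F (Var 0) (Var 1) ?C2"
  let ?E = "Ty TN # E" and ?G = "lift ` insert (decidable_set C) G" and ?x = "Var 0"
  \<comment> \<open>This is \<open>Ex1 TB ?A\<close> unfolded: under the uniqueness quantifier the
    number is \<open>Var 2\<close> and the set is lifted three times.\<close>
  let ?X = "Ex (Ty TB) (And ?A (All (Ty TB) (Imp (?F (Var 0) (Var 2) ?C3) (Eq TB (Var 0) (Var 1)))))"
  have wf: "wf_fm (Ty TB # Ty TN # E) ?A" using assms by simp
  \<comment> \<open>The bit \<open>b\<close> will be \<open>b1\<close> or \<open>b0\<close>; the
    last assumption is its uniqueness.\<close>
  have intro_X: "?E; H \<turnstile> ?X"
    if "?E; H \<turnstile> ?F b ?x ?C" and b: "srt ?E b = Some (Ty TB)" "\<And>\<sigma>. tsubst \<sigma> b = b" "srt (Ty TB # ?E) b = Some (Ty TB)"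
      and "Ty TB # ?E; insert (?F (Var 0) (Var 1) ?C2) (lift ` H) \<turnstile> Eq TB (Var 0) b" for H b
  proof (rule ex_intro[of _ _ b])
    have "?E; H \<turnstile> All (Ty TB) (Imp (?F (Var 0) (Var 1) ?C2) (Eq TB (Var 0) b))"
      by (intro derivable.AllI derivable.ImpI that) (use assms in simp_all)
    with that(1) show "?E; H \<turnstile> inst b
        (And ?A (All (Ty TB) (Imp (?F (Var 0) (Var 2) ?C3) (Eq TB (Var 0) (Var 1)))))"
      using b by (simp add: inst_def derivable.AndI)
  qed (use assms b in simp_all)
  have X: "?E; ?G \<turnstile> ?X"
  proof (rule derivable.OrE)
    have "?E; ?G \<turnstile> decidable_set ?C" by (rule derivable.Hyp) (use assms in simp_all)
    then show "?E; ?G \<turnstile> Or (Mem ?x ?C) (Not (Mem ?x ?C))"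
      unfolding decidable_set_def by (rule all_elim[where t = "Var 0"]) (simp_all add: inst_def)
    let ?H = "insert (Mem ?x ?C) ?G"
    show "?E; ?H \<turnstile> ?X"
    proof (rule intro_X[of _ b1])
      show "?E; ?H \<turnstile> ?F b1 ?x ?C"
        by (rule derivable.OrI1[OF derivable.AndI[OF eqv_refl hyp]]) (use assms in simp_all)
      let ?K = "insert (?F (Var 0) (Var 1) ?C2) (lift ` ?H)"
      show "Ty TB # ?E; ?K \<turnstile> Eq TB (Var 0) b1"
      proof (rule derivable.OrE[OF hyp])
        let ?J = "And (Eq TB (Var 0) b1) (Mem (Var 1) ?C2)"
        show "Ty TB # ?E; insert ?J ?K \<turnstile> Eq TB (Var 0) b1"
          by (rule derivable.AndE1[OF hyp]) (use assms in simp)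
        let ?J = "And (Eq TB (Var 0) b0) (Not (Mem (Var 1) ?C2))"
        have "Ty TB # ?E; insert ?J ?K \<turnstile> Bot"
          by (rule derivable.ImpE[OF derivable.AndE2[OF hyp] derivable.Hyp]) (use assms in simp_all)
        then show "Ty TB # ?E; insert ?J ?K \<turnstile> Eq TB (Var 0) b1" by (rule derivable.BotE) simp
      qed (use assms in simp)
    qed simp_all
    let ?H = "insert (Not (Mem ?x ?C)) ?G"
    show "?E; ?H \<turnstile> ?X"
    proof (rule intro_X[of _ b0])
      show "?E; ?H \<turnstile> ?F b0 ?x ?C"
        by (rule derivable.OrI2[OF _ derivable.AndI[OF eqv_refl hyp]]) (use assms in simp_all)
      let ?K = "insert (?F (Var 0) (Var 1) ?C2) (lift ` ?H)"
      show "Ty TB # ?E; ?K \<turnstile> Eq TB (Var 0) b0"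
      proof (rule derivable.OrE[OF hyp])
        let ?J = "And (Eq TB (Var 0) b1) (Mem (Var 1) ?C2)"
        have "Ty TB # ?E; insert ?J ?K \<turnstile> Bot"
          by (rule derivable.ImpE[OF derivable.Hyp derivable.AndE2[OF hyp]]) (use assms in simp_all)
        then show "Ty TB # ?E; insert ?J ?K \<turnstile> Eq TB (Var 0) b0" by (rule derivable.BotE) simp
        let ?J = "And (Eq TB (Var 0) b0) (Not (Mem (Var 1) ?C2))"
        show "Ty TB # ?E; insert ?J ?K \<turnstile> Eq TB (Var 0) b0"
          by (rule derivable.AndE1[OF hyp]) (use assms in simp)
      qed (use assms in simp)
    qed simp_all
  qed
  have "E; insert (decidable_set C) G \<turnstile> All (Ty TN) (Ex1 TB ?A)"
    using derivable.AllI[OF X] by (simp add: Ex1_def lift1_def numeral_2_eq_2)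
  moreover have "E; insert (decidable_set C) G \<turnstile> AC_fm ?A"
  proof (rule derivable.Ax)
    show "(E, AC_fm ?A) \<in> T" using assms(1) wf unfolding AC_unique_0B_def by blast
    show "wf_fm E (AC_fm ?A)" using assms by (simp add: AC_fm_def Ex1_def lift1_def)
  qed
  ultimately have "E; insert (decidable_set C) G \<turnstile> Ex (Ty cantor) (All (Ty TN)
      (subst (case_nat (Var 1 \<bullet> Var 0) (case_nat (Var 0) (\<lambda>n. Var (n + 2)))) ?A))"
    unfolding AC_fm_def by (rule derivable.ImpE[rotated])
  then have "E; insert (decidable_set C) G \<turnstile> Ex (Ty cantor) (char_of (Var 0) (tlift C))"
    by (simp add: char_of_def)
  then show ?thesis by (rule cut[OF assms(2)])
qed

lemma barred_nil:
  assumes "AC_unique_0B \<subseteq> T" "EnDec \<subseteq> T" "srt E p = Some (Ty (TN \<rightharpoondown> TSeq))"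
  shows "E; {progressive p} \<turnstile> barred p nil"
proof -
  let ?B = "good (tlift p) (Var 0)"
  let ?E = "PowN # E" and ?p = "tlift p" and ?C = "Var 0"
  let ?D = "And (decidable_set ?C) (good_subset ?C ?p)"
  let ?G = "{proper ?C, ?D, progressive ?p}"
  have D: "?E; ?G \<turnstile> ?D" by (rule derivable.Hyp) (use assms in simp_all)
  have "?E; ?G \<turnstile> Ex (Ty cantor) (char_of (Var 0) (tlift ?C))"
    by (rule char_of_exists[OF assms(1) derivable.AndE1[OF D]]) simp
  \<comment> \<open>The conjunct is added on its own so that the context contains
    \<open>hyps\<close> once the characteristic function is fixed.\<close>
  then have "?E; insert (good_subset ?C ?p) ?G \<turnstile> Ex (Ty cantor) (char_of (Var 0) (tlift ?C))"
    by (rule weaken_insert)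
  then have "?E; insert (good_subset ?C ?p) ?G \<turnstile> good_outside ?C ?p"
  proof (rule derivable.ExE)
    have "Ty cantor # ?E; hyps (Var 0) (tlift ?C) (tlift ?p) \<turnstile> good_outside (tlift ?C) (tlift ?p)"
      by (rule good_outside) (use assms in simp_all)
    then show "Ty cantor # ?E; insert (char_of (Var 0) (tlift ?C)) (lift ` insert (good_subset ?C ?p) ?G) \<turnstile>
        lift (good_outside ?C ?p)"
      by (simp add: hyps_def) (erule weaken, auto)
  qed (use assms in simp)
  with derivable.AndE2[OF D] have "?E; ?G \<turnstile> good_outside ?C ?p" by (rule cut)
  then have "E; {progressive p} \<turnstile> All PowN (Imp ?D (Imp (proper ?C) (good_outside ?C ?p)))"
    by (intro derivable.AllI derivable.ImpI) (use assms in simp_all)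
  then have prem: "E; {progressive p} \<turnstile> All PowN
      (Imp (And (decidable_set (Var 0)) (All (Ty TN) (Imp (Mem (Var 0) (Var 1)) (lift1 ?B))))
        (Imp (Ex (Ty TN) (Not (Mem (Var 0) (Var 1))))
          (Ex (Ty TN) (And (Not (Mem (Var 0) (Var 1))) (lift1 ?B)))))"
    by (simp add: good_subset_def proper_def good_outside_def lift1_def)
  have wf: "wf_fm (Ty TN # E) ?B" using assms by simp
  have "E; {progressive p} \<turnstile> EnDec_fm ?B"
  proof (rule derivable.Ax)
    \<comment> \<open>Both disjuncts are existential equations of numbers, as EnDec demands of
      \<open>B\<close>.\<close>
    have "sigma_fm ?B" unfolding good_def by (intro sigma_fm.intros sigma_barred)
    then show "(E, EnDec_fm ?B) \<in> T" using assms(2) wf unfolding EnDec_def by blast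
    show "wf_fm E (EnDec_fm ?B)" using entails_wf[OF prem] wf by (simp add: EnDec_fm_def)
  qed
  \<comment> \<open>The number \<open>zero\<close> codes the empty sequence, so there both disjuncts
    of \<open>good\<close> say that the root is barred.\<close>
  from derivable.ImpE[OF this[unfolded EnDec_fm_def] prem]
  have "E; {progressive p} \<turnstile> good p zero"
    by (rule all_elim[where t = zero]) (simp_all add: inst_def)
  then show ?thesis
    unfolding good_def
  proof (rule derivable.OrE)
    show "E; {barred p (dec zero), progressive p} \<turnstile> barred p nil"
      by (rule barred_cong[OF dec_zero hyp]) (use assms in simp_all)
    show "E; {barred p nil, progressive p} \<turnstile> barred p nil"
      by (rule hyp) (use assms in simp)
  qed
qed

text \<open>Every sequence passes through the root, its segment of length zero.\<close>

lemma enum_by_all: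
  assumes "AC_unique_0B \<subseteq> T" "EnDec \<subseteq> T" "srt E p = Some (Ty (TN \<rightharpoondown> TSeq))"
  shows "E; {progressive p} \<turnstile> All (Ty cantor) (enum_by (tlift p) (Var 0))"
proof (rule derivable.AllI)
  have "Ty cantor # E; {progressive (tlift p)} \<turnstile> barred (tlift p) nil"
    by (rule barred_nil) (use assms in simp_all)
  then have "Ty cantor # E; {progressive (tlift p)} \<turnstile> barred (tlift p) (init_seg (Var 0) zero)"
    by (rule barred_cong[OF eqv_sym[OF init_seg_zero], rotated]) (use assms in simp_all)
  then have "Ty cantor # E; {progressive (tlift p)} \<turnstile> enum_by (tlift p) (Var 0)"
    by (rule barred_sound) (use assms in simp_all)
  then show "Ty cantor # E; lift ` {progressive p} \<turnstile> enum_by (tlift p) (Var 0)" by simp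
qed

section \<open>Open induction for an arbitrary open set\<close>

text \<open>Translates between \<open>U\<close> and its enumeration: \<open>?P\<close> gives
  \<open>progressive p\<close>, and the resulting statement about \<open>enum_by\<close> is carried
  back to \<open>U\<close>.\<close>

lemma open_set_induction:
  assumes "AC_unique_0B \<subseteq> T" "EnDec \<subseteq> T" "srt E p = Some (Ty (TN \<rightharpoondown> TSeq))"
    and wf: "wf_fm (Ty cantor # E) U"
    and opn: "All (Ty cantor) (Iff U (enum_by (tlift p) (Var 0))) \<in> G" (is "?O \<in> G")
    and prog: "All (Ty cantor) (Imp (All (Ty cantor) (Imp (lex_less (Var 0) (Var 1)) (lift1 U))) U) \<in> G"
      (is "?P \<in> G")
  shows "E; G \<turnstile> All (Ty cantor) U"
proof -
  let ?E = "Ty cantor # E" and ?p = "tlift p" and ?p2 = "tlift (tlift p)" and ?a = "Var 0"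
  have wf_lift1: "wf_fm (Ty cantor # ?E) (lift1 U)"
    unfolding lift1_def by (rule wf_subst[OF wf]) (auto simp: nth_Cons split: nat.splits)
  have wfO: "wf_fm E ?O" using wf assms by simp
  have wfP: "wf_fm E ?P" using wf wf_lift1 by simp
  \<comment> \<open>The equivalence at the current point, available under any larger set of
    assumptions.\<close>
  have O: "?E; H \<turnstile> Iff U (enum_by ?p (Var 0))" if "lift ` G \<subseteq> H" for H
  proof -
    have "?E; H \<turnstile> lift ?O"
      by (rule derivable.Hyp) (use opn that wf_lift[OF wfO] in \<open>auto simp del: subst.simps\<close>)
    then show ?thesis
      unfolding subst.simps by (rule all_elim[where t = "Var 0"]) (simp, simp add: inst_def up_lift tsubst_case_nat case_nat_Var)
  qed
  \<comment> \<open>The hypothesis of \<open>progressive p\<close> at the current point; it is first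
    turned into the corresponding statement about \<open>U\<close>.\<close>
  let ?below = "All (Ty cantor) (Imp (lex_less (Var 0) (Var 1)) (enum_by ?p2 (Var 0)))"
  let ?H = "insert ?below (lift ` G)"
  let ?K = "insert (lex_less (Var 0) (Var 1)) (lift ` ?H)"
  have "Ty cantor # ?E; ?K \<turnstile> lift1 U"
  proof (rule derivable.ImpE)
    \<comment> \<open>Here the equivalence is taken at the smaller point, hence the second
      lifting.\<close>
    have "Ty cantor # ?E; ?K \<turnstile> lift (lift ?O)"
      by (rule derivable.Hyp)
        (use opn wf_lift[OF wf_lift[OF wfO]] in \<open>auto simp del: subst.simps subst_subst\<close>)
    then have "Ty cantor # ?E; ?K \<turnstile> Iff (lift1 U) (enum_by ?p2 (Var 0))"
      unfolding subst.simps
      by (rule all_elim[where t = "Var 0"]) (simp, simp add: inst_def lift1_def up_lift tsubst_case_nat case_nat_Var)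
    then show "Ty cantor # ?E; ?K \<turnstile> Imp (enum_by ?p2 (Var 0)) (lift1 U)" by (rule derivable.AndE2)
    have "Ty cantor # ?E; ?K \<turnstile> lift ?below"
      by (rule derivable.Hyp) (use assms in simp_all)
    then have "Ty cantor # ?E; ?K \<turnstile> Imp (lex_less (Var 0) (Var 1)) (enum_by ?p2 (Var 0))"
      unfolding subst.simps by (rule all_elim[where t = "Var 0"]) (simp_all add: inst_def)
    then show "Ty cantor # ?E; ?K \<turnstile> enum_by ?p2 (Var 0)"
      by (rule derivable.ImpE[OF _ hyp]) simp
  qed
  then have all: "?E; ?H \<turnstile> All (Ty cantor) (Imp (lex_less (Var 0) (Var 1)) (lift1 U))"
    by (intro derivable.AllI derivable.ImpI) simp_all
  have "?E; ?H \<turnstile> lift ?P"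
    by (rule derivable.Hyp) (use prog wf_lift[OF wfP] in \<open>auto simp del: subst.simps\<close>)
  then have "?E; ?H \<turnstile> Imp (All (Ty cantor) (Imp (lex_less (Var 0) (Var 1)) (lift1 U))) U"
    unfolding subst.simps
    by (rule all_elim[where t = "Var 0"]) (simp, simp add: inst_def lift1_def up_lift tsubst_case_nat case_nat_Var)
  then have "?E; ?H \<turnstile> U" using all by (rule derivable.ImpE)
  with derivable.AndE1[OF O] have "?E; ?H \<turnstile> enum_by ?p (Var 0)"
    by (rule derivable.ImpE) auto
  then have "E; G \<turnstile> progressive p"
    unfolding progressive_def by (intro derivable.AllI derivable.ImpI) (use assms in simp_all)
  then have "E; G \<turnstile> All (Ty cantor) (enum_by ?p (Var 0))"
    by (rule cut) (rule weaken[OF enum_by_all], use assms in auto)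
  then show ?thesis
  proof (rule cut, intro derivable.AllI)
    let ?A = "All (Ty cantor) (enum_by ?p (Var 0))"
    have "?E; lift ` insert ?A G \<turnstile> lift ?A" by (rule derivable.Hyp) (use assms in simp_all)
    then have "?E; lift ` insert ?A G \<turnstile> enum_by ?p (Var 0)"
      unfolding subst.simps by (rule all_elim[where t = "Var 0"]) (simp_all add: inst_def)
    with derivable.AndE2[OF O] show "?E; lift ` insert ?A G \<turnstile> U"
      by (rule derivable.ImpE) auto
  qed
qed

lemma open_induction_derivable:
  assumes "AC_unique_0B \<subseteq> T" "EnDec \<subseteq> T" and wf: "wf_fm (Ty cantor # E) U"
  shows "E; {} \<turnstile> OI_fm U"
proof -
  let ?N = "And (Ex (Ty cantor) U) (open_fm U)"
  let ?P = "All (Ty cantor) (Imp (All (Ty cantor) (Imp (lex_less (Var 0) (Var 1)) (lift1 U))) U)"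
  let ?E = "Ty (TN \<rightharpoondown> TSeq) # E"
  have wf1: "wf_fm (Ty cantor # s # E) (lift1 U)" for s
    unfolding lift1_def by (rule wf_subst[OF wf]) (auto simp: nth_Cons split: nat.splits)
  have wfP: "wf_fm E ?P" using wf wf1 by simp
  have wfN: "wf_fm E ?N" using wf wf1 by (simp add: open_fm_def)
  have "E; {?P, ?N} \<turnstile> open_fm U"
    by (rule derivable.AndE2[OF derivable.Hyp[of ?N]]) (use wfN in simp_all)
  then have "E; {?P, ?N} \<turnstile> All (Ty cantor) U"
    unfolding open_fm_def
  proof (rule derivable.ExE)
    \<comment> \<open>The enumeration becomes the new variable 0 of the context, so \<open>U\<close>
      must make room for it directly above the point: hence \<open>lift1 U\<close>, with
      \<open>Var 0\<close> as \<open>p\<close>.\<close>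
    let ?O = "All (Ty cantor) (Iff (lift1 U) (enum_by (Var 1) (Var 0)))"
    have "?E; insert ?O (lift ` {?P, ?N}) \<turnstile> All (Ty cantor) (lift1 U)"
      by (rule open_set_induction[where p = "Var 0"])
        (use assms(1,2) wf1 in \<open>simp_all add: lift1_def up_lift tsubst_case_nat\<close>)
    then show "?E; insert ?O (lift ` {?P, And (Ex (Ty cantor) U) (Ex (Ty (TN \<rightharpoondown> TSeq)) ?O)}) \<turnstile>
        lift (All (Ty cantor) U)"
      by (simp add: lift1_def up_lift open_fm_def)
  qed (use wf in simp)
  then show ?thesis
    unfolding OI_fm_def by (intro derivable.ImpI) (use wfP wfN in simp_all)
qed

end

theorem theorem1:
  fixes T :: thy
  assumes "AC_unique_0B \<subseteq> T"
    and "EnDec \<subseteq> T"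
  shows "\<forall>(E, A) \<in> open_induction. derivable T E {} A"
  using open_induction_derivable[OF assms] by (auto simp: open_induction_def)

end
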